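(* There exist $\varepsilon > 0$ and $n_0 \in \mathbb{N}$ such that the following holds for all integers $n \ge n_0$ that are divisible by $3$. Suppose $H$ is a $3$-uniform hypergraph on $n$ vertices with no isolated vertex and $\sigma_2'(H) > \frac{2}{3}n^2 - \varepsilon n^2$. Then either $H \subseteq H^*$ (that is, $V(H)$ can be partitioned into sets $S$ and $T$ with $|S| = n/3+1$ and $|T| = 2n/3-1$ such that every edge of $H$ contains at least two vertices of $T$), or $H$ contains a perfect matching.
   Context: A $3$-uniform hypergraph $H=(V,E)$ has edges that are $3$-element subsets of $V$. The degree $\deg(v)$ of a vertex is the number of edges containing it; a vertex is isolated if its degree is $0$. Two distinct vertices $u,v$ are adjacent if some edge contains both. $\sigma_2'(H) = \min\{\deg(u)+\deg(v) : u,v \text{ adjacent in } H\}$. $H^*$ denotes the $3$-graph on $n$ vertices whose vertex set is partitioned into $S$ of size $n/3+1$ and $T$ of size $2n/3-1$, with edge set all triples containing at least two vertices of $T$. A perfect matching is a set of pairwise disjoint edges covering all vertices. *)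

theory Defs
  imports Complex_Main "HOL-Library.Disjoint_Sets"
begin

definition three_graph :: "'a set \<Rightarrow> 'a set set \<Rightarrow> bool" where
  "three_graph V E \<longleftrightarrow> finite V \<and> (\<forall>e\<in>E. e \<subseteq> V \<and> card e = 3)"

definition hdegree :: "'a set set \<Rightarrow> 'a \<Rightarrow> nat" where
  "hdegree E v = card {e \<in> E. v \<in> e}"

definition hadjacent :: "'a set set \<Rightarrow> 'a \<Rightarrow> 'a \<Rightarrow> bool" where
  "hadjacent E u v \<longleftrightarrow> u \<noteq> v \<and> (\<exists>e\<in>E. u \<in> e \<and> v \<in> e)"

text \<open>The minimum is over a nonempty set as soon as there is an edge, in particular for every
  3-graph with at least one vertex and without isolated vertices.\<close>

definition sigma2' :: "'a set set \<Rightarrow> nat" where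
  "sigma2' E = Min {hdegree E u + hdegree E v | u v. hadjacent E u v}"

text \<open>The edge set of \<open>H\<^sup>*\<close> for a given partition of the vertex set into \<open>S\<close> and \<open>T\<close>.\<close>

definition Hstar_edges :: "'a set \<Rightarrow> 'a set \<Rightarrow> 'a set set" where
  "Hstar_edges S T = {e. e \<subseteq> S \<union> T \<and> card e = 3 \<and> card (e \<inter> T) \<ge> 2}"

definition sub_Hstar :: "'a set \<Rightarrow> 'a set set \<Rightarrow> bool" where
  "sub_Hstar V E \<longleftrightarrow>
     (\<exists>S T. S \<union> T = V \<and> S \<inter> T = {} \<and>
            real (card S) = real (card V) / 3 + 1 \<and> real (card T) = 2 * real (card V) / 3 - 1 \<and>
            E \<subseteq> Hstar_edges S T)"

definition perfect_matching :: "'a set \<Rightarrow> 'a set set \<Rightarrow> 'a set set \<Rightarrow> bool" where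
  "perfect_matching V E M \<longleftrightarrow> M \<subseteq> E \<and> disjoint M \<and> \<Union>M = V"

end

theory Submission
  imports Defs
begin

text \<open>
  Degrees are measured by links of ordered pairs, so that a vertex has degree at most \<open>n\<^sup>2\<close> and
  the threshold for a vertex is \<open>2/3 n\<^sup>2\<close>. If a matching \<open>M\<close> of a hypergraph cannot be enlarged and
  \<open>x\<close>, \<open>y\<close>, \<open>z\<close> are uncovered, then for two matching edges \<open>a\<close>, \<open>b\<close> there are no three disjoint
  edges consisting of one of \<open>x\<close>, \<open>y\<close>, \<open>z\<close>, one vertex of \<open>a\<close> and one of \<open>b\<close>; averaging, the three
  links have at most 18 of the 27 pairs on \<open>a \<times> b\<close>. Hence the degree sum of \<open>x\<close>, \<open>y\<close>, \<open>z\<close> is at most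
  \<open>2 n\<^sup>2 + O(n)\<close>, so adjacent vertices of degree sum above \<open>4/3 n\<^sup>2\<close> are
  only an \<open>\<epsilon> n\<^sup>2\<close> away from a contradiction.

  With six uncovered vertices the extremal case is rigid: on almost all \<open>a \<times> b\<close> the links of four
  uncovered vertices coincide and miss exactly the pairs at one vertex of \<open>a\<close> or of \<open>b\<close>. Exchanging
  uncovered and covered vertices, almost all vertices have this link, which is contradictory. So all
  degrees above \<open>(2/3 - c) n\<^sup>2\<close> force a matching that misses three vertices, and a small
  family of absorbing gadgets, chosen greedily, takes these three in.

  In general let \<open>W\<close> be the set of vertices of low degree, below \<open>(2/3 - \<epsilon>) n\<^sup>2\<close>; no edge has two vertices
  in \<open>W\<close>, so the graph is contained in \<open>H\<^sup>*\<close> when \<open>|W| > n/3\<close>. A small \<open>W\<close> is covered greedily. If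
  \<open>W\<close> is neither small nor too big, pass to an edge-maximal counterexample among the hypergraphs
  whose edges meet \<open>W\<close> at most once. Every missing edge \<open>xyz\<close> is then disjoint from a matching that
  covers all other vertices, so its degree sum is at most \<open>2 n\<^sup>2 + O(n)\<close>, and smaller by a positive
  proportion of \<open>n\<^sup>2\<close> if it meets \<open>W\<close>, since pairs of vertices in \<open>W\<close> lie in no link. This forces so
  many edges that a perfect matching is found directly or from the result for large minimum degree.
\<close>

section \<open>Links\<close>

definition link :: "'a set set \<Rightarrow> 'a \<Rightarrow> ('a \<times> 'a) set" where
  "link E v = {(p, q). {v, p, q} \<in> E}"

definition link_dense :: "real \<Rightarrow> 'a set \<Rightarrow> 'a set set \<Rightarrow> bool" where
  "link_dense c V E \<longleftrightarrow> (\<forall>v\<in>V. c * (real (card V))\<^sup>2 \<le> real (card (link E v)))"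

definition induced :: "'a set set \<Rightarrow> 'a set \<Rightarrow> 'a set set" where
  "induced E U = {e \<in> E. e \<subseteq> U}"

lemma link_iff [simp]: "(p, q) \<in> link E v \<longleftrightarrow> {v, p, q} \<in> E"
  by (simp add: link_def)

lemma card_triple_iff: "card {x, y, z} = 3 \<longleftrightarrow> distinct [x, y, z]"
  by (auto simp: card_insert_if)

lemma three_graph_finite_vertices: "three_graph V E \<Longrightarrow> finite V"
  by (simp add: three_graph_def)

lemma three_graph_finite: "three_graph V E \<Longrightarrow> finite E"
  unfolding three_graph_def by (meson PowI finite_Pow_iff finite_subset subsetI)

lemma three_graph_edge:
  assumes "three_graph V E" "{x, y, z} \<in> E"
  shows "distinct [x, y, z]" "x \<in> V" "y \<in> V" "z \<in> V"
  using assms card_triple_iff[of x y z] unfolding three_graph_def by auto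

lemma three_graph_finite_edge: "three_graph V E \<Longrightarrow> e \<in> E \<Longrightarrow> finite e"
  by (auto simp: three_graph_def intro: finite_subset)

lemma three_graph_subset: "three_graph V E \<Longrightarrow> F \<subseteq> E \<Longrightarrow> three_graph V F"
  by (auto simp: three_graph_def)

lemma three_graph_induced: "three_graph V E \<Longrightarrow> U \<subseteq> V \<Longrightarrow> three_graph U (induced E U)"
  by (simp add: three_graph_def induced_def finite_subset)

lemma link_subset: "three_graph V E \<Longrightarrow> link E v \<subseteq> V \<times> V"
  unfolding link_def using three_graph_edge(3,4)[of V E v] by blast

lemma finite_link: "three_graph V E \<Longrightarrow> finite (link E v)"
  by (rule finite_subset[OF link_subset], assumption) (simp add: three_graph_def)

lemma card_link_le:
  assumes "three_graph V E"
  shows "card (link E v) \<le> (card V)\<^sup>2"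
  using card_mono[OF _ link_subset[OF assms]] three_graph_finite_vertices[OF assms]
  by (simp add: card_cartesian_product power2_eq_square)

lemma card_link_mono: "three_graph V F \<Longrightarrow> E \<subseteq> F \<Longrightarrow> card (link E v) \<le> card (link F v)"
  by (intro card_mono finite_link) (auto simp: link_def)

lemma link_dense_mono:
  assumes "three_graph V F" "E \<subseteq> F" "link_dense c V E"
  shows "link_dense c V F"
  unfolding link_dense_def
  using assms(3) card_link_mono[OF assms(1,2)] by (meson link_dense_def of_nat_mono order_trans)

lemma triple_containing:
  assumes "card a = 3" "p \<in> a"
  obtains q r where "{p, q, r} = a" "distinct [p, q, r]"
proof -
  have "card (a - {p}) = 2" using assms by simp
  then obtain q r where "a - {p} = {q, r}" "q \<noteq> r" by (meson card_2_iff)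
  then show ?thesis using that[of q r] assms(2) by auto
qed

lemma triple_containing_pair:
  assumes "card a = 3" "p \<in> a" "p' \<in> a" "p \<noteq> p'"
  obtains p'' where "{p, p', p''} = a"
proof -
  obtain q r where a: "{p, q, r} = a" by (rule triple_containing[OF assms(1,2)])
  then consider "p' = q" | "p' = r" using assms(3,4) by blast
  then have "{p, p', if p' = q then r else q} = a" using a by auto
  then show ?thesis by (rule that)
qed

lemma ordered_pairs_completing_triple:
  assumes "card e = 3" "v \<in> e"
  shows "card {(p, q). {v, p, q} = e} = 2"
proof -
  obtain p q where e: "{v, p, q} = e" and dist: "distinct [v, p, q]"
    by (rule triple_containing[OF assms])
  have "(x, y) = (p, q) \<or> (x, y) = (q, p)" if "{v, x, y} = e" for x y
  proof -
    have "distinct [v, x, y]" using that assms(1) card_triple_iff[of v x y] by simp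
    moreover have "x \<in> {v, p, q}" "y \<in> {v, p, q}" using that e by auto
    ultimately show ?thesis by auto
  qed
  then have "{(p, q). {v, p, q} = e} = {(p, q), (q, p)}" using e by (auto simp: insert_commute)
  then show ?thesis using dist by simp
qed

lemma card_link:
  assumes "three_graph V E"
  shows "card (link E v) = 2 * hdegree E v"
proof -
  let ?F = "{e \<in> E. v \<in> e}" and ?P = "\<lambda>e. {(p, q). {v, p, q} = e}"
  have two: "card (?P e) = 2" if "e \<in> ?F" for e
    using that assms by (intro ordered_pairs_completing_triple) (auto simp: three_graph_def)
  then have "finite (?P e)" if "e \<in> ?F" for e
    using that by (intro card_ge_0_finite) simp
  moreover have "link E v = (\<Union>e\<in>?F. ?P e)" by (auto simp: link_def)
  moreover have "finite ?F" using three_graph_finite[OF assms] by simp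
  ultimately have "card (link E v) = (\<Sum>e\<in>?F. card (?P e))"
    by (simp only:) (rule card_UN_disjoint; auto)
  also have "\<dots> = (\<Sum>e\<in>?F. 2)" by (intro sum.cong refl two)
  finally show ?thesis by (simp add: hdegree_def)
qed

lemma card_link_complete_star:
  assumes tg: "three_graph V E" and v: "v \<in> V"
    and star: "\<And>e. e \<subseteq> V \<Longrightarrow> card e = 3 \<Longrightarrow> v \<in> e \<Longrightarrow> e \<in> E"
  shows "(card V - 1) * (card V - 2) \<le> card (link E v)"
proof -
  have finV: "finite V" using tg by (rule three_graph_finite_vertices)
  have "(SIGMA p:V - {v}. V - {v} - {p}) \<subseteq> link E v"
  proof
    fix x assume "x \<in> (SIGMA p:V - {v}. V - {v} - {p})"
    then obtain p q where x: "x = (p, q)" "p \<in> V" "q \<in> V" "distinct [v, p, q]" by auto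
    then have "{v, p, q} \<in> E" using v card_triple_iff[of v p q] by (intro star) auto
    then show "x \<in> link E v" using x by simp
  qed
  then have "card (SIGMA p:V - {v}. V - {v} - {p}) \<le> card (link E v)"
    by (intro card_mono finite_link[OF tg])
  moreover have "card (SIGMA p:V - {v}. V - {v} - {p}) = (\<Sum>p\<in>V - {v}. card (V - {v} - {p}))"
    using finV by (intro card_SigmaI) auto
  moreover have "\<dots> = (\<Sum>p\<in>V - {v}. card V - 2)"
    using finV v by (intro sum.cong refl) simp
  ultimately show ?thesis using v finV by (simp add: numeral_2_eq_2)
qed

lemma card_le_add_cross:
  assumes "R \<subseteq> X \<union> (D \<times> V \<union> V \<times> D)" "finite X" "finite D" "finite V"
  shows "card R \<le> card X + 2 * card D * card V"
proof -
  have "card R \<le> card (X \<union> (D \<times> V \<union> V \<times> D))" using assms by (intro card_mono) auto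
  also have "\<dots> \<le> card X + (card (D \<times> V) + card (V \<times> D))"
    by (rule order_trans[OF card_Un_le add_left_mono[OF card_Un_le]])
  finally show ?thesis by (simp add: card_cartesian_product algebra_simps)
qed

lemma card_link_induced:
  assumes tg: "three_graph V E" and "U \<subseteq> V" "v \<in> U"
  shows "card (link E v) \<le> card (link (induced E U) v) + 2 * card (V - U) * card V"
proof (rule card_le_add_cross)
  show "link E v \<subseteq> link (induced E U) v \<union> ((V - U) \<times> V \<union> V \<times> (V - U))"
    using link_subset[OF tg, of v] assms(3) by (auto simp: link_def induced_def)
qed (use three_graph_finite_vertices[OF tg] finite_link[OF three_graph_induced[OF assms(1,2)]] in auto)

lemma link_dense_induced:
  assumes tg: "three_graph V E" and U: "U \<subseteq> V" and c: "0 \<le> c"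
    and deg: "\<And>v. v \<in> U \<Longrightarrow> (c + \<delta>) * (real (card V))\<^sup>2 \<le> real (card (link E v))"
    and few: "2 * real (card (V - U)) \<le> \<delta> * real (card V)"
  shows "link_dense c U (induced E U)"
  unfolding link_dense_def
proof
  fix v assume v: "v \<in> U"
  let ?n = "real (card V)"
  have "real (card (link E v)) \<le> real (card (link (induced E U) v)) + 2 * real (card (V - U)) * ?n"
    using of_nat_mono[OF card_link_induced[OF tg U v]] by simp
  moreover have "2 * real (card (V - U)) * ?n \<le> \<delta> * ?n\<^sup>2"
    using mult_right_mono[OF few, of ?n] by (simp add: power2_eq_square)
  moreover have "c * (real (card U))\<^sup>2 \<le> c * ?n\<^sup>2"
    using U c three_graph_finite_vertices[OF tg] by (intro mult_left_mono power_mono) (auto simp: card_mono)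
  ultimately show "c * (real (card U))\<^sup>2 \<le> real (card (link (induced E U) v))"
    using deg[OF v] by (simp add: algebra_simps)
qed

section \<open>Matchings\<close>

definition matching :: "'a set set \<Rightarrow> 'a set set \<Rightarrow> bool" where
  "matching E M \<longleftrightarrow> M \<subseteq> E \<and> disjoint M"

lemma matching_empty: "matching E {}"
  by (simp add: matching_def)

lemma matching_singleton: "e \<in> E \<Longrightarrow> matching E {e}"
  by (simp add: matching_def)

lemma matching_mono: "matching E M \<Longrightarrow> E \<subseteq> F \<Longrightarrow> matching F M"
  by (auto simp: matching_def)

lemma matching_subset: "matching E M \<Longrightarrow> N \<subseteq> M \<Longrightarrow> matching E N"
  unfolding matching_def by (blast intro: pairwise_subset)

lemma matching_inter_empty: "matching E M \<Longrightarrow> a \<in> M \<Longrightarrow> b \<in> M \<Longrightarrow> a \<noteq> b \<Longrightarrow> a \<inter> b = {}"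
  unfolding matching_def by (meson disjointD)

lemma matching_Union_Diff: "matching E M \<Longrightarrow> N \<subseteq> M \<Longrightarrow> \<Union>(M - N) = \<Union>M - \<Union>N"
  using matching_inter_empty[of E M] by fastforce

lemma matching_finite: "three_graph V E \<Longrightarrow> matching E M \<Longrightarrow> finite M"
  by (meson finite_subset matching_def three_graph_finite)

lemma matching_card_edge: "three_graph V E \<Longrightarrow> matching E M \<Longrightarrow> e \<in> M \<Longrightarrow> card e = 3"
  by (auto simp: matching_def three_graph_def)

lemma matching_card_Union:
  assumes tg: "three_graph V E" and M: "matching E M"
  shows "card (\<Union>M) = 3 * card M" "\<Union>M \<subseteq> V" "finite (\<Union>M)"
proof -
  have "card (\<Union>M) = (\<Sum>e\<in>M. card e)"
    using M three_graph_finite_edge[OF tg]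
    by (intro card_Union_disjoint) (auto simp: matching_def)
  also have "\<dots> = (\<Sum>e\<in>M. 3)" using matching_card_edge[OF tg M] by (intro sum.cong) auto
  finally show "card (\<Union>M) = 3 * card M" by simp
  show "\<Union>M \<subseteq> V" using assms by (auto simp: matching_def three_graph_def)
  then show "finite (\<Union>M)" using three_graph_finite_vertices[OF tg] by (rule finite_subset)
qed

lemma card_uncovered:
  assumes "three_graph V E" "matching E M"
  shows "card (V - \<Union>M) = card V - 3 * card M"
  using matching_card_Union[OF assms] by (simp add: card_Diff_subset)

lemma perfect_matching_iff:
  assumes tg: "three_graph V E"
  shows "perfect_matching V E M \<longleftrightarrow> matching E M \<and> 3 * card M = card V"
proof
  assume "perfect_matching V E M"
  then have "matching E M" "\<Union>M = V" by (simp_all add: perfect_matching_def matching_def)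
  then show "matching E M \<and> 3 * card M = card V" using matching_card_Union(1)[OF tg] by auto
next
  assume M: "matching E M \<and> 3 * card M = card V"
  then have "\<Union>M = V"
    using matching_card_Union[OF tg] three_graph_finite_vertices[OF tg] by (intro card_subset_eq) auto
  then show "perfect_matching V E M" using M by (simp add: perfect_matching_def matching_def)
qed

lemma matching_Un:
  assumes tg: "three_graph V E" and "matching E M" "matching E N" "\<Union>M \<inter> \<Union>N = {}"
  shows "matching E (M \<union> N)" "card (M \<union> N) = card M + card N"
proof -
  show "matching E (M \<union> N)"
    using assms(2-) unfolding matching_def by (auto intro!: disjoint_union)
  have "M \<inter> N = {}"
  proof -
    have "e = {}" if "e \<in> M" "e \<in> N" for e using that assms(4) by blast
    then show ?thesis using matching_card_edge[OF tg assms(2)] by force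
  qed
  then show "card (M \<union> N) = card M + card N"
    using matching_finite[OF tg] assms(2,3) by (simp add: card_Un_disjoint)
qed

lemma matching_replace:
  assumes tg: "three_graph V E" and M: "matching E M" and N: "N \<subseteq> M" and N': "matching E N'"
    and only: "\<Union>N' \<inter> \<Union>M \<subseteq> \<Union>N"
  shows "matching E (M - N \<union> N')" "card (M - N \<union> N') = card M - card N + card N'"
    "\<Union>(M - N \<union> N') = \<Union>M - \<Union>N \<union> \<Union>N'"
proof -
  have U: "\<Union>(M - N) = \<Union>M - \<Union>N" by (rule matching_Union_Diff[OF M N])
  then have "\<Union>(M - N) \<inter> \<Union>N' = {}" using only by blast
  note un = matching_Un[OF tg matching_subset[OF M Diff_subset] N' this]
  show "matching E (M - N \<union> N')" by (rule un(1))
  show "card (M - N \<union> N') = card M - card N + card N'"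
    using un(2) N matching_finite[OF tg M] by (simp add: card_Diff_subset finite_subset)
  show "\<Union>(M - N \<union> N') = \<Union>M - \<Union>N \<union> \<Union>N'" using U by simp
qed

lemma matching_three_edges:
  assumes tg: "three_graph V E" and E: "e \<in> E" "f \<in> E" "g \<in> E"
    and dis: "e \<inter> f = {}" "e \<inter> g = {}" "f \<inter> g = {}"
  shows "matching E {e, f, g}" "card {e, f, g} = 3"
proof -
  show "matching E {e, f, g}"
    using E dis by (auto simp: matching_def pairwise_insert disjnt_def)
  have "e \<noteq> {}" "f \<noteq> {}" using tg E by (auto simp: three_graph_def)
  then have "distinct [e, f, g]" using dis by auto
  then show "card {e, f, g} = 3" by (simp add: card_triple_iff)
qed

lemma perfect_matching_remove:
  assumes tg: "three_graph V E" and R: "matching E R"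
    and M: "perfect_matching (V - \<Union>R) (induced E (V - \<Union>R)) M"
  shows "perfect_matching V E (R \<union> M)"
proof -
  have "matching E M" "\<Union>M = V - \<Union>R"
    using M by (auto simp: perfect_matching_def matching_def induced_def)
  then show ?thesis
    using matching_Un(1)[OF tg R, of M] matching_card_Union(2)[OF tg R]
    by (auto simp: perfect_matching_def matching_def)
qed

definition strongly_independent :: "'a set set \<Rightarrow> 'a set \<Rightarrow> bool" where
  "strongly_independent E W \<longleftrightarrow> (\<forall>u\<in>W. \<forall>v\<in>W. \<not> hadjacent E u v)"

lemma strongly_independentD:
  "strongly_independent E W \<Longrightarrow> e \<in> E \<Longrightarrow> u \<in> e \<Longrightarrow> v \<in> e \<Longrightarrow> u \<in> W \<Longrightarrow> v \<in> W \<Longrightarrow> u = v"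
  by (auto simp: strongly_independent_def hadjacent_def)

lemma strongly_independent_iff_card:
  assumes "three_graph V E"
  shows "strongly_independent E W \<longleftrightarrow> (\<forall>e\<in>E. card (e \<inter> W) \<le> 1)"
proof -
  have "card (e \<inter> W) \<le> 1 \<longleftrightarrow> (\<forall>u\<in>e \<inter> W. \<forall>v\<in>e \<inter> W. u = v)" if "e \<in> E" for e
    using card_le_Suc0_iff_eq[of "e \<inter> W"] three_graph_finite_edge[OF assms that] by simp
  then show ?thesis by (auto simp: strongly_independent_def hadjacent_def)
qed

section \<open>Blocks of a link between two matching edges\<close>

abbreviation block :: "'a set set \<Rightarrow> 'a \<Rightarrow> 'a set \<Rightarrow> 'a set \<Rightarrow> nat" where
  "block E v a b \<equiv> card (link E v \<inter> a \<times> b)"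

definition misses_exactly :: "'a set set \<Rightarrow> 'a \<Rightarrow> 'a \<Rightarrow> 'a set \<Rightarrow> 'a set \<Rightarrow> bool" where
  "misses_exactly E v r a b \<longleftrightarrow> (\<forall>p\<in>a. \<forall>q\<in>b. {v, p, q} \<in> E \<longleftrightarrow> p \<noteq> r)"

definition tight :: "'a set set \<Rightarrow> 'a set \<Rightarrow> 'a set \<Rightarrow> 'a set \<Rightarrow> bool" where
  "tight E Q a b \<longleftrightarrow>
     (\<exists>r\<in>a. \<forall>v\<in>Q. misses_exactly E v r a b) \<or> (\<exists>r\<in>b. \<forall>v\<in>Q. misses_exactly E v r b a)"

definition nontight :: "'a set set \<Rightarrow> 'a set set \<Rightarrow> 'a set \<Rightarrow> ('a set \<times> 'a set) set" where
  "nontight E M Q = {(a, b). a \<in> M \<and> b \<in> M \<and> a \<noteq> b \<and> \<not> tight E Q a b}"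

lemma block_eq_sum:
  assumes "finite a" "finite b"
  shows "block E v a b = (\<Sum>p\<in>a. \<Sum>q\<in>b. of_bool ({v, p, q} \<in> E))"
proof -
  have "block E v a b = (\<Sum>x\<in>a \<times> b. of_bool (x \<in> link E v))"
    using assms by (simp add: sum.If_cases Int_commute of_bool_def)
  then show ?thesis by (simp add: sum.cartesian_product case_prod_beta' link_def)
qed

lemma block_le:
  assumes "finite a" "finite b"
  shows "block E v a b \<le> card a * card b"
  using card_mono[of "a \<times> b" "link E v \<inter> a \<times> b"] assms by (simp add: card_cartesian_product)

lemma misses_exactly_unique:
  assumes "misses_exactly E v r a b" "misses_exactly E v r' a b" "r \<in> a" "b \<noteq> {}"
  shows "r = r'"
  using assms unfolding misses_exactly_def by blast

lemma not_misses_exactly_both: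
  assumes "misses_exactly E v r a b" "misses_exactly E v r' b a" "card a = 3" "r \<in> a" "r' \<in> b"
  shows False
proof -
  obtain p where p: "p \<in> a" "p \<noteq> r" by (rule triple_containing[OF assms(3,4)]) auto
  then have "{v, p, r'} \<in> E" "{v, r', p} \<notin> E" using assms unfolding misses_exactly_def by blast+
  then show False by (simp add: insert_commute)
qed

lemma misses_exactly_edge:
  assumes "misses_exactly E v r a b" "card a = 3" "r \<in> a" "b \<noteq> {}"
  obtains p q where "p \<in> a" "q \<in> b" "{v, p, q} \<in> E"
proof -
  obtain p where "p \<in> a" "p \<noteq> r" by (rule triple_containing[OF assms(2,3)]) auto
  moreover obtain q where "q \<in> b" using assms(4) by blast
  ultimately show ?thesis using that assms(1) unfolding misses_exactly_def by blast
qed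

lemma nontight_subset: "nontight E M Q \<subseteq> M \<times> M"
  by (auto simp: nontight_def)

lemma finite_nontight: "finite M \<Longrightarrow> finite (nontight E M Q)"
  by (rule finite_subset[OF nontight_subset]) simp

lemma card_nontight_change:
  assumes "finite M" "finite M'"
  shows "card (nontight E M Q) \<le> card (nontight E M' Q) + 2 * card (M - M') * card M"
proof (rule card_le_add_cross)
  show "nontight E M Q \<subseteq> nontight E M' Q \<union> ((M - M') \<times> M \<union> M \<times> (M - M'))"
    by (auto simp: nontight_def)
qed (use assms finite_nontight in auto)

lemma
  fixes f g h :: "'a \<Rightarrow> 'b \<Rightarrow> nat"
  assumes a: "{p0, p1, p2} = a" "distinct [p0, p1, p2]" and b: "{q0, q1, q2} = b" "distinct [q0, q1, q2]"
    and le: "\<And>p0 p1 p2 q0 q1 q2. {p0, p1, p2} = a \<Longrightarrow> {q0, q1, q2} = b \<Longrightarrow>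
      f p0 q0 + g p1 q1 + h p2 q2 \<le> c"
  shows transversal_sum_le:
      "(\<Sum>p\<in>a. \<Sum>q\<in>b. f p q) + (\<Sum>p\<in>a. \<Sum>q\<in>b. g p q) + (\<Sum>p\<in>a. \<Sum>q\<in>b. h p q) \<le> 9 * c"
    and transversal_eq_if_sum_eq:
      "(\<Sum>p\<in>a. \<Sum>q\<in>b. f p q) + (\<Sum>p\<in>a. \<Sum>q\<in>b. g p q) + (\<Sum>p\<in>a. \<Sum>q\<in>b. h p q) = 9 * c \<Longrightarrow>
      f p0 q0 + g p1 q1 + h p2 q2 = c"
proof -
  let ?S = "(\<Sum>p\<in>a. \<Sum>q\<in>b. f p q) + (\<Sum>p\<in>a. \<Sum>q\<in>b. g p q) + (\<Sum>p\<in>a. \<Sum>q\<in>b. h p q)"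
  \<comment> \<open>The nine translates of a transversal by \<open>\<int>\<^sub>3 \<times> \<int>\<^sub>3\<close> use each of the 27 cells once.\<close>
  have S: "?S = (f p0 q0 + g p1 q1 + h p2 q2) + (f p0 q1 + g p1 q2 + h p2 q0) + (f p0 q2 + g p1 q0 + h p2 q1)
    + (f p1 q0 + g p2 q1 + h p0 q2) + (f p1 q1 + g p2 q2 + h p0 q0) + (f p1 q2 + g p2 q0 + h p0 q1)
    + (f p2 q0 + g p0 q1 + h p1 q2) + (f p2 q1 + g p0 q2 + h p1 q0) + (f p2 q2 + g p0 q0 + h p1 q1)"
    unfolding a(1)[symmetric] b(1)[symmetric] using a(2) b(2) by (simp add: algebra_simps)
  have rot: "{p1, p2, p0} = a" "{p2, p0, p1} = a" "{q1, q2, q0} = b" "{q2, q0, q1} = b"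
    using a(1) b(1) by auto
  note translates = le[OF a(1) b(1)] le[OF a(1) rot(3)] le[OF a(1) rot(4)]
    le[OF rot(1) b(1)] le[OF rot(1) rot(3)] le[OF rot(1) rot(4)]
    le[OF rot(2) b(1)] le[OF rot(2) rot(3)] le[OF rot(2) rot(4)]
  show "?S \<le> 9 * c" unfolding S using translates by linarith
  show "f p0 q0 + g p1 q1 + h p2 q2 = c" if "?S = 9 * c"
    using that translates unfolding S by linarith
qed

lemma one_miss_per_transversal:
  assumes a: "card a = 3" and b: "card b = 3"
    and one: "\<And>p0 p1 p2 q0 q1 q2. {p0, p1, p2} = a \<Longrightarrow> {q0, q1, q2} = b \<Longrightarrow>
      of_bool (f p0 q0) + of_bool (f p1 q1) + of_bool (f p2 q2) = (2::nat)"
  shows "(\<exists>r\<in>a. \<forall>p\<in>a. \<forall>q\<in>b. f p q \<longleftrightarrow> p \<noteq> r) \<or> (\<exists>r\<in>b. \<forall>p\<in>a. \<forall>q\<in>b. f p q \<longleftrightarrow> q \<noteq> r)"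
proof -
  have aligned: "p = p' \<or> q = q'"
    if miss: "p \<in> a" "q \<in> b" "\<not> f p q" "p' \<in> a" "q' \<in> b" "\<not> f p' q'" for p q p' q'
  proof (rule ccontr)
    assume "\<not> (p = p' \<or> q = q')"
    then obtain p'' q'' where "{p, p', p''} = a" "{q, q', q''} = b"
      using triple_containing_pair[OF a miss(1,4)] triple_containing_pair[OF b miss(2,5)] by metis
    from one[OF this] show False using miss(3,6) by (simp add: of_bool_def split: if_splits)
  qed
  have elsewhere: "\<exists>p'\<in>a. \<exists>q'\<in>b. p' \<noteq> p \<and> q' \<noteq> q \<and> \<not> f p' q'" if pq: "p \<in> a" "q \<in> b" "f p q" for p q
  proof -
    obtain p1 p2 where p: "{p, p1, p2} = a" "distinct [p, p1, p2]" by (rule triple_containing[OF a pq(1)])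
    obtain q1 q2 where q: "{q, q1, q2} = b" "distinct [q, q1, q2]" by (rule triple_containing[OF b pq(2)])
    from one[OF p(1) q(1)] pq(3) have "\<not> f p1 q1 \<or> \<not> f p2 q2" by auto
    then show ?thesis using p q by auto
  qed
  have "a \<noteq> {}" "b \<noteq> {}" using a b by auto
  then obtain p0 q0 where zero: "p0 \<in> a" "q0 \<in> b" "\<not> f p0 q0" using elsewhere by blast
  show ?thesis
  proof (cases "\<exists>q1\<in>b. q1 \<noteq> q0 \<and> \<not> f p0 q1")
    case True
    then have "p = p0" if "p \<in> a" "q \<in> b" "\<not> f p q" for p q
      using aligned[OF that zero] aligned[OF that zero(1)] by blast
    then have "\<forall>p\<in>a. \<forall>q\<in>b. f p q \<longleftrightarrow> p \<noteq> p0" using elsewhere by blast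
    then show ?thesis using zero(1) by blast
  next
    case False
    then have "q = q0" if "p \<in> a" "q \<in> b" "\<not> f p q" for p q
      using aligned[OF that zero] that by blast
    then have "\<forall>p\<in>a. \<forall>q\<in>b. f p q \<longleftrightarrow> q \<noteq> q0" using elsewhere by blast
    then show ?thesis using zero(2) by blast
  qed
qed

lemma
  fixes f :: "'a \<Rightarrow> nat"
  assumes Q: "card Q \<ge> 2" and le: "\<And>v. v \<in> Q \<Longrightarrow> sum f (Q - {v}) \<le> (card Q - 1) * c"
  shows sum_le_if_leave_one_out_le: "sum f Q \<le> card Q * c"
    and const_if_leave_one_out_le: "sum f Q = card Q * c \<Longrightarrow> v \<in> Q \<Longrightarrow> f v = c"
proof -
  have fin: "finite Q" using Q by (intro card_ge_0_finite) simp
  obtain r where r: "card Q = Suc (Suc r)" using Q by (metis add_2_eq_Suc le_Suc_ex)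
  have split: "f v + sum f (Q - {v}) = sum f Q" if "v \<in> Q" for v
    using fin that by (simp add: sum.remove)
  have "(\<Sum>v\<in>Q. f v + sum f (Q - {v})) = (\<Sum>v\<in>Q. sum f Q)" by (intro sum.cong refl split)
  then have "sum f Q + (\<Sum>v\<in>Q. sum f (Q - {v})) = card Q * sum f Q" by (simp add: sum.distrib)
  moreover have "(\<Sum>v\<in>Q. sum f (Q - {v})) \<le> (\<Sum>v\<in>Q. (card Q - 1) * c)" by (intro sum_mono le)
  ultimately have "Suc r * sum f Q \<le> Suc r * (card Q * c)" using r by (simp add: algebra_simps)
  then show "sum f Q \<le> card Q * c" by (simp only: Suc_mult_le_cancel1)
  assume total: "sum f Q = card Q * c" and v: "v \<in> Q"
  have ge: "c \<le> f u" if "u \<in> Q" for u using le[OF that] split[OF that] total r by simp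
  have "(\<Sum>u\<in>Q - {v}. c) \<le> sum f (Q - {v})" using ge by (intro sum_mono) auto
  then have "(card Q - 1) * c \<le> sum f (Q - {v})" using v fin by simp
  then show "f v = c" using split[OF v] ge[OF v] total r by simp
qed

locale three_uniform =
  fixes V :: "'a set" and E
  assumes tg: "three_graph V E"
begin

lemma finite_V: "finite V"
  by (rule three_graph_finite_vertices[OF tg])

end

locale stuck_matching = three_uniform +
  fixes M
  assumes M: "matching E M"
    and stuck: "\<And>M'. matching E M' \<Longrightarrow> card M' \<noteq> Suc (card M)"
begin

lemma finite_M: "finite M"
  by (rule matching_finite[OF tg M])

lemma card_edge: "a \<in> M \<Longrightarrow> card a = 3"
  by (rule matching_card_edge[OF tg M])

lemma finite_edge: "a \<in> M \<Longrightarrow> finite a"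
  using card_edge by (simp add: card_ge_0_finite)

lemma card_ge_2: "a \<in> M \<Longrightarrow> b \<in> M \<Longrightarrow> a \<noteq> b \<Longrightarrow> 2 \<le> card M"
  using card_mono[of M "{a, b}"] finite_M by simp

lemma no_rainbow_transversal:
  assumes ab: "a \<in> M" "b \<in> M" "a \<noteq> b" and p: "{p0, p1, p2} = a" and q: "{q0, q1, q2} = b"
    and xyz: "distinct [x, y, z]" "{x, y, z} \<inter> \<Union>M = {}"
  shows "\<not> ({x, p0, q0} \<in> E \<and> {y, p1, q1} \<in> E \<and> {z, p2, q2} \<in> E)"
proof
  assume E: "{x, p0, q0} \<in> E \<and> {y, p1, q1} \<in> E \<and> {z, p2, q2} \<in> E"
  let ?N = "{{x, p0, q0}, {y, p1, q1}, {z, p2, q2}}"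
  have "distinct [p0, p1, p2]" "distinct [q0, q1, q2]"
    using card_edge[OF ab(1)] card_edge[OF ab(2)] by (simp_all add: card_triple_iff flip: p q)
  moreover have "a \<inter> b = {}" by (rule matching_inter_empty[OF M ab])
  moreover have "{x, y, z} \<inter> (a \<union> b) = {}" using ab xyz by blast
  ultimately have dist: "distinct [x, y, z, p0, p1, p2, q0, q1, q2]"
    using xyz(1) p q by auto
  have N: "matching E ?N" "card ?N = 3"
    by (rule matching_three_edges[OF tg]; use E dist in auto)+
  have "\<Union>?N \<inter> \<Union>M \<subseteq> \<Union>{a, b}" using xyz(2) p q by auto
  then have "matching E (M - {a, b} \<union> ?N)" "card (M - {a, b} \<union> ?N) = card M - card {a, b} + card ?N"
    using matching_replace[OF tg M _ N(1), of "{a, b}"] ab by auto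
  then show False using stuck[of "M - {a, b} \<union> ?N"] N(2) ab(3) card_ge_2[OF ab] by simp
qed

lemma
  assumes ab: "a \<in> M" "b \<in> M" "a \<noteq> b" and xyz: "distinct [x, y, z]" "{x, y, z} \<inter> \<Union>M = {}"
  shows three_blocks_le: "block E x a b + block E y a b + block E z a b \<le> 18"
    and two_of_transversal_if_sum_eq_18:
      "block E x a b + block E y a b + block E z a b = 18 \<Longrightarrow> {p0, p1, p2} = a \<Longrightarrow> {q0, q1, q2} = b \<Longrightarrow>
      of_bool ({x, p0, q0} \<in> E) + of_bool ({y, p1, q1} \<in> E) + of_bool ({z, p2, q2} \<in> E) = (2::nat)"
proof -
  let ?f = "\<lambda>v p q. of_bool ({v, p, q} \<in> E) :: nat"
  have two: "?f x p0 q0 + ?f y p1 q1 + ?f z p2 q2 \<le> 2"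
    if "{p0, p1, p2} = a" "{q0, q1, q2} = b" for p0 p1 p2 q0 q1 q2
    using no_rainbow_transversal[OF ab that xyz] by auto
  note blk = block_eq_sum[OF finite_edge[OF ab(1)] finite_edge[OF ab(2)]]
  obtain p0 p1 p2 where p: "{p0, p1, p2} = a" "distinct [p0, p1, p2]"
    using card_edge[OF ab(1)] by (auto simp: card_3_iff)
  obtain q0 q1 q2 where q: "{q0, q1, q2} = b" "distinct [q0, q1, q2]"
    using card_edge[OF ab(2)] by (auto simp: card_3_iff)
  show "block E x a b + block E y a b + block E z a b \<le> 18"
    using transversal_sum_le[OF p q, of "?f x" "?f y" "?f z" 2] two unfolding blk by simp
  show "?f x p0 q0 + ?f y p1 q1 + ?f z p2 q2 = 2"
    if "block E x a b + block E y a b + block E z a b = 18" "{p0, p1, p2} = a" "{q0, q1, q2} = b"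
    for p0 p1 p2 q0 q1 q2
  proof -
    have "distinct [p0, p1, p2]" "distinct [q0, q1, q2]"
      using card_edge[OF ab(1)] card_edge[OF ab(2)] card_triple_iff[of p0 p1 p2] card_triple_iff[of q0 q1 q2]
        that(2,3) by simp_all
    from transversal_eq_if_sum_eq[OF that(2) this(1) that(3) this(2), of "?f x" "?f y" "?f z" 2]
    show ?thesis using two that(1) unfolding blk by simp
  qed
qed

lemma sum_three_blocks_le:
  assumes ab: "a \<in> M" "b \<in> M" "a \<noteq> b" and Q: "card Q = 3" "Q \<inter> \<Union>M = {}"
  shows "(\<Sum>v\<in>Q. block E v a b) \<le> 18"
proof -
  obtain x y z where "Q = {x, y, z}" "distinct [x, y, z]" using Q(1) by (auto simp: card_3_iff)
  then show ?thesis using three_blocks_le[OF ab, of x y z] Q(2) by (simp add: add.assoc)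
qed

lemma three_blocks_le_17:
  assumes ab: "a \<in> M" "b \<in> M" "a \<noteq> b" and xyz: "distinct [x, y, z]" "{x, y, z} \<inter> \<Union>M = {}"
    and W: "strongly_independent E W" "x \<in> W" "a \<inter> W \<noteq> {}" "b \<inter> W \<noteq> {}"
  shows "block E x a b + block E y a b + block E z a b \<le> 17"
proof (rule ccontr)
  assume "\<not> ?thesis"
  then have "block E x a b + block E y a b + block E z a b = 18"
    using three_blocks_le[OF ab xyz] by linarith
  note two = two_of_transversal_if_sum_eq_18[OF ab xyz this]
  obtain w w' where w: "w \<in> a" "w \<in> W" and w': "w' \<in> b" "w' \<in> W" using W by blast
  obtain a1 a2 where a: "{w, a1, a2} = a" using triple_containing[OF card_edge[OF ab(1)] w(1)] by metis
  obtain b1 b2 where b: "{w', b1, b2} = b" using triple_containing[OF card_edge[OF ab(2)] w'(1)] by metis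
  have "w \<noteq> x" "w' \<noteq> x" "w \<noteq> w'"
    using xyz(2) ab w w' matching_inter_empty[OF M ab] by auto
  then have missing: "{x, w, q} \<notin> E" "{x, p, w'} \<notin> E" "{v, w, w'} \<notin> E" for v p q
    using strongly_independentD[OF W(1)] W(2) w(2) w'(2) by blast+
  have perm: "{a1, w, a2} = a" "{a1, a2, w} = a" "{b2, w', b1} = b" "{w', b1, b2} = b" "{b1, w', b2} = b"
    "{b1, b2, w'} = b" "{b2, b1, w'} = b"
    using a b by auto
  \<comment> \<open>Each missing cell forces the other two cells of its transversal; three forced cells form a transversal.\<close>
  have "{x, a1, b2} \<in> E" using two[OF perm(1) perm(3)] missing(3)[of y]
    by (simp add: of_bool_def split: if_splits)
  moreover have "{y, w, b1} \<in> E" using two[OF perm(1) perm(4)] missing(2)[of a1]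
    by (simp add: of_bool_def split: if_splits)
  moreover have "{z, a2, w'} \<in> E" using two[OF a perm(6)] missing(1)[of b1]
    by (simp add: of_bool_def split: if_splits)
  ultimately show False using two[OF perm(1) perm(7)] by simp
qed

lemma
  assumes ab: "a \<in> M" "b \<in> M" "a \<noteq> b" and Q: "card Q = 4" "Q \<inter> \<Union>M = {}"
  shows sum_four_blocks_le: "(\<Sum>v\<in>Q. block E v a b) \<le> 24"
    and block_eq_6_if_sum_eq_24: "(\<Sum>v\<in>Q. block E v a b) = 24 \<Longrightarrow> v \<in> Q \<Longrightarrow> block E v a b = 6"
proof -
  have "(\<Sum>u\<in>Q - {v}. block E u a b) \<le> (card Q - 1) * 6" if "v \<in> Q" for v
    using sum_three_blocks_le[OF ab, of "Q - {v}"] that Q by auto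
  note leave_one_out = this
  show "(\<Sum>v\<in>Q. block E v a b) \<le> 24"
    using sum_le_if_leave_one_out_le[OF _ leave_one_out] Q(1) by simp
  show "block E v a b = 6" if "(\<Sum>v\<in>Q. block E v a b) = 24" "v \<in> Q"
    using const_if_leave_one_out_le[OF _ leave_one_out _ that(2)] that Q(1) by simp
qed

lemma links_agree_if_sum_eq_24:
  assumes ab: "a \<in> M" "b \<in> M" "a \<noteq> b" and Q: "card Q = 4" "Q \<inter> \<Union>M = {}"
    and eq: "(\<Sum>v\<in>Q. block E v a b) = 24"
    and uv: "u \<in> Q" "v \<in> Q" and pq: "p \<in> a" "q \<in> b"
  shows "{u, p, q} \<in> E \<longleftrightarrow> {v, p, q} \<in> E"
proof (cases "u = v")
  case False
  have "card (Q - {u, v}) = 2" using Q(1) uv False by (simp add: card_Diff_subset)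
  then obtain s t where st: "Q - {u, v} = {s, t}" "s \<noteq> t" by (meson card_2_iff)
  then have "s \<in> Q - {u, v}" "t \<in> Q - {u, v}" by simp_all
  then have mem: "s \<in> Q" "t \<in> Q" "distinct [u, s, t]" "distinct [v, s, t]" using st(2) by auto
  note six = block_eq_6_if_sum_eq_24[OF ab Q eq]
  obtain p1 p2 where p: "{p, p1, p2} = a" using triple_containing[OF card_edge[OF ab(1)] pq(1)] by metis
  obtain q1 q2 where q: "{q, q1, q2} = b" using triple_containing[OF card_edge[OF ab(2)] pq(2)] by metis
  have "of_bool ({w, p, q} \<in> E) + of_bool ({s, p1, q1} \<in> E) + of_bool ({t, p2, q2} \<in> E) = (2::nat)"
    if w: "w \<in> Q" "distinct [w, s, t]" for w
  proof (rule two_of_transversal_if_sum_eq_18[OF ab w(2) _ _ p q])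
    show "{w, s, t} \<inter> \<Union>M = {}" using w(1) mem(1,2) Q(2) by blast
    show "block E w a b + block E s a b + block E t a b = 18" using six w(1) mem(1,2) by simp
  qed
  from this[OF uv(1) mem(3)] this[OF uv(2) mem(4)]
  have "of_bool ({u, p, q} \<in> E) = (of_bool ({v, p, q} \<in> E) :: nat)" by linarith
  then show ?thesis by (simp only: of_bool_eq_iff)
qed simp

lemma misses_exactly_if_sum_eq_24:
  assumes ab: "a \<in> M" "b \<in> M" "a \<noteq> b" and Q: "card Q = 4" "Q \<inter> \<Union>M = {}"
    and eq: "(\<Sum>v\<in>Q. block E v a b) = 24" and x: "x \<in> Q"
  shows "(\<exists>r\<in>a. misses_exactly E x r a b) \<or> (\<exists>r\<in>b. misses_exactly E x r b a)"
proof -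
  have "2 \<le> card (Q - {x})" using Q(1) x by simp
  then obtain S where S: "S \<subseteq> Q - {x}" "card S = 2" by (rule obtain_subset_with_card_n)
  then obtain y z where "S = {y, z}" "y \<noteq> z" by (meson card_2_iff)
  with S(1) have yz: "y \<in> Q" "z \<in> Q" "distinct [x, y, z]" by auto
  have out: "{x, y, z} \<inter> \<Union>M = {}" using x yz Q(2) by blast
  have "block E x a b + block E y a b + block E z a b = 18"
    using block_eq_6_if_sum_eq_24[OF ab Q eq] x yz by simp
  note two = two_of_transversal_if_sum_eq_18[OF ab yz(3) out this]
  have "of_bool ({x, p0, q0} \<in> E) + of_bool ({x, p1, q1} \<in> E) + of_bool ({x, p2, q2} \<in> E) = (2::nat)"
    if pq: "{p0, p1, p2} = a" "{q0, q1, q2} = b" for p0 p1 p2 q0 q1 q2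
  proof -
    have "p1 \<in> a" "p2 \<in> a" "q1 \<in> b" "q2 \<in> b" using pq by auto
    then have "{x, p1, q1} \<in> E \<longleftrightarrow> {y, p1, q1} \<in> E" "{x, p2, q2} \<in> E \<longleftrightarrow> {z, p2, q2} \<in> E"
      using links_agree_if_sum_eq_24[OF ab Q eq] x yz by blast+
    then show ?thesis using two[OF pq] by simp
  qed
  from one_miss_per_transversal[OF card_edge[OF ab(1)] card_edge[OF ab(2)], of "\<lambda>p q. {x, p, q} \<in> E", OF this]
  have "(\<exists>r\<in>a. \<forall>p\<in>a. \<forall>q\<in>b. {x, p, q} \<in> E \<longleftrightarrow> p \<noteq> r) \<or> (\<exists>r\<in>b. \<forall>q\<in>b. \<forall>p\<in>a. {x, p, q} \<in> E \<longleftrightarrow> q \<noteq> r)"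
    by blast
  moreover have "{x, p, q} = {x, q, p}" for p q by auto
  ultimately show ?thesis unfolding misses_exactly_def by simp
qed

lemma tight_if_sum_eq_24:
  assumes ab: "a \<in> M" "b \<in> M" "a \<noteq> b" and Q: "card Q = 4" "Q \<inter> \<Union>M = {}"
    and eq: "(\<Sum>v\<in>Q. block E v a b) = 24"
  shows "tight E Q a b"
proof -
  have "Q \<noteq> {}" using Q(1) by auto
  then obtain x where x: "x \<in> Q" by blast
  have agree: "{v, p, q} \<in> E \<longleftrightarrow> {x, p, q} \<in> E" if "v \<in> Q" "p \<in> a" "q \<in> b" for v p q
    using links_agree_if_sum_eq_24[OF ab Q eq that(1) x that(2,3)] .
  have "misses_exactly E v r a b" if "v \<in> Q" "misses_exactly E x r a b" for v r
    using agree that by (simp add: misses_exactly_def)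
  moreover have "misses_exactly E v r b a" if "v \<in> Q" "misses_exactly E x r b a" for v r
    unfolding misses_exactly_def
  proof (intro ballI)
    fix q p assume qp: "q \<in> b" "p \<in> a"
    then have "{x, q, p} \<in> E \<longleftrightarrow> q \<noteq> r" using that(2) by (simp add: misses_exactly_def)
    then show "{v, q, p} \<in> E \<longleftrightarrow> q \<noteq> r"
      unfolding insert_commute[of q p] using agree[OF that(1) qp(2,1)] by simp
  qed
  ultimately show ?thesis
    using misses_exactly_if_sum_eq_24[OF ab Q eq x] unfolding tight_def by blast
qed

lemma sum_four_blocks_nontight:
  assumes "a \<in> M" "b \<in> M" "a \<noteq> b" "card Q = 4" "Q \<inter> \<Union>M = {}"
  shows "(\<Sum>v\<in>Q. block E v a b) + of_bool ((a, b) \<in> nontight E M Q) \<le> 24"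
proof (cases "(\<Sum>v\<in>Q. block E v a b) = 24")
  case True
  then have "tight E Q a b" by (rule tight_if_sum_eq_24[OF assms])
  then show ?thesis using True by (simp add: nontight_def)
next
  case False
  then have "(\<Sum>v\<in>Q. block E v a b) < 24" using sum_four_blocks_le[OF assms] by simp
  then show ?thesis by simp
qed

lemma card_link_le_blocks:
  "card (link E v) \<le> (\<Sum>(a, b)\<in>M \<times> M. block E v a b) + 2 * card (V - \<Union>M) * card V"
proof -
  let ?B = "\<Union>(a, b)\<in>M \<times> M. link E v \<inter> a \<times> b"
  have "card (link E v) \<le> card ?B + 2 * card (V - \<Union>M) * card V"
  proof (rule card_le_add_cross)
    show "link E v \<subseteq> ?B \<union> ((V - \<Union>M) \<times> V \<union> V \<times> (V - \<Union>M))"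
    proof
      fix x assume x: "x \<in> link E v"
      then obtain p q where pq: "x = (p, q)" "p \<in> V" "q \<in> V" using link_subset[OF tg, of v] by blast
      show "x \<in> ?B \<union> ((V - \<Union>M) \<times> V \<union> V \<times> (V - \<Union>M))"
      proof (cases "p \<in> \<Union>M \<and> q \<in> \<Union>M")
        case True
        then obtain a b where "(a, b) \<in> M \<times> M" "p \<in> a" "q \<in> b" by blast
        then have "x \<in> ?B" using x pq(1) by blast
        then show ?thesis by blast
      qed (use pq in auto)
    qed
  qed (use finite_M finite_V finite_link[OF tg] in auto)
  moreover have "card ?B \<le> (\<Sum>x\<in>M \<times> M. card (case x of (a, b) \<Rightarrow> link E v \<inter> a \<times> b))"
    using finite_M by (intro card_UN_le) auto
  ultimately show ?thesis by (simp add: case_prod_beta')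
qed

lemma sum_card_link_le_blocks:
  "(\<Sum>v\<in>Q. card (link E v))
    \<le> (\<Sum>(a, b)\<in>M \<times> M. \<Sum>v\<in>Q. block E v a b) + 2 * card Q * card (V - \<Union>M) * card V"
proof -
  have "(\<Sum>v\<in>Q. card (link E v))
      \<le> (\<Sum>v\<in>Q. (\<Sum>(a, b)\<in>M \<times> M. block E v a b) + 2 * card (V - \<Union>M) * card V)"
    by (intro sum_mono card_link_le_blocks)
  then show ?thesis
    by (simp add: sum.distrib sum.swap[of _ "M \<times> M" Q] case_prod_beta')
qed

lemma link_sum_le:
  assumes P: "P \<subseteq> M \<times> M" "\<And>a. (a, a) \<notin> P"
    and off: "\<And>a b. a \<in> M \<Longrightarrow> b \<in> M \<Longrightarrow> a \<noteq> b \<Longrightarrow>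
      (\<Sum>v\<in>Q. block E v a b) + of_bool ((a, b) \<in> P) \<le> c"
  shows "(\<Sum>v\<in>Q. card (link E v)) + card P
    \<le> c * (card M)\<^sup>2 + 9 * card Q * card M + 2 * card Q * card (V - \<Union>M) * card V"
proof -
  let ?S = "\<lambda>a b. \<Sum>v\<in>Q. block E v a b"
  have diag: "?S a a \<le> 9 * card Q" if "a \<in> M" for a
  proof -
    have "?S a a \<le> (\<Sum>v\<in>Q. 9)"
      using block_le[OF finite_edge[OF that] finite_edge[OF that]] card_edge[OF that]
      by (intro sum_mono) simp
    then show ?thesis by simp
  qed
  have "card P = (\<Sum>(a, b)\<in>M \<times> M. of_bool ((a, b) \<in> P))"
    using finite_M P(1) by (simp add: sum.If_cases of_bool_def Int_absorb1)
  then have "(\<Sum>(a, b)\<in>M \<times> M. ?S a b) + card P = (\<Sum>(a, b)\<in>M \<times> M. ?S a b + of_bool ((a, b) \<in> P))"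
    by (simp add: sum.distrib case_prod_beta')
  also have "\<dots> \<le> (\<Sum>(a, b)\<in>M \<times> M. c + 9 * card Q * of_bool (a = b))"
  proof (rule sum_mono, clarify)
    fix a b assume "a \<in> M" "b \<in> M"
    then show "?S a b + of_bool ((a, b) \<in> P) \<le> c + 9 * card Q * of_bool (a = b)"
      using off[of a b] diag[of a] P(2)[of a] by (cases "a = b") auto
  qed
  also have "\<dots> = (\<Sum>a\<in>M. \<Sum>b\<in>M. c + 9 * card Q * of_bool (a = b))"
    by (simp add: sum.cartesian_product)
  also have "\<dots> = c * (card M)\<^sup>2 + 9 * card Q * card M"
    using finite_M by (simp add: sum.distrib power2_eq_square sum_distrib_left[symmetric] of_bool_def algebra_simps)
  finally show ?thesis using sum_card_link_le_blocks[of Q] by linarith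
qed

end

section \<open>Six uncovered vertices\<close>

context stuck_matching
begin

lemma swap_two_edges:
  assumes ab: "a \<in> M" "b \<in> M" "a \<noteq> b" and a: "{r, s, s'} = a" and b: "{t, t1, t2} = b"
    and xy: "x \<noteq> y" "{x, y} \<inter> \<Union>M = {}" "{x, s, t1} \<in> E" "{y, s', t2} \<in> E"
  defines "M' \<equiv> M - {a, b} \<union> {{x, s, t1}, {y, s', t2}}"
  shows "matching E M'" "card M' = card M" "\<Union>M' = \<Union>M - {r, t} \<union> {x, y}"
proof -
  let ?N = "{{x, s, t1}, {y, s', t2}}"
  have "distinct [r, s, s']" "distinct [t, t1, t2]"
    using card_edge[OF ab(1)] card_edge[OF ab(2)] by (simp_all add: card_triple_iff flip: a b)
  moreover have "a \<inter> b = {}" by (rule matching_inter_empty[OF M ab])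
  moreover have "{x, y} \<inter> (a \<union> b) = {}" using ab xy(2) by blast
  ultimately have dist: "distinct [x, y, r, s, s', t, t1, t2]" using xy(1) a b by auto
  then have N: "matching E ?N" "card ?N = 2"
    using xy(3,4) by (auto simp: matching_def pairwise_insert disjnt_def card_insert_if doubleton_eq_iff)
  have "{a, b} \<subseteq> M" "\<Union>?N \<inter> \<Union>M \<subseteq> \<Union>{a, b}" using ab xy(2) a b by auto
  note rep = matching_replace[OF tg M this(1) N(1) this(2), folded M'_def]
  show "matching E M'" by (rule rep(1))
  show "card M' = card M" using rep(2) N(2) ab(3) card_ge_2[OF ab] by simp
  have "\<Union>M = (\<Union>M - \<Union>{a, b}) \<union> {r, s, s', t, t1, t2}" using ab a b by auto
  moreover have "\<Union>{a, b} = {r, s, s', t, t1, t2}" "\<Union>?N = {x, s, t1, y, s', t2}" using a b by auto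
  ultimately show "\<Union>M' = \<Union>M - {r, t} \<union> {x, y}" using rep(3) dist by auto
qed

end

locale near_perfect = stuck_matching +
  assumes six: "card V = 3 * card M + 6" and large: "card M \<ge> 30000"
    and dense: "link_dense (2/3 - 1/10000) V E"
begin

definition m :: real where
  "m = real (card M)"

lemma m_ge: "m \<ge> 30000"
  using large by (simp add: m_def)

lemma m_le_square: "30000 * m \<le> m\<^sup>2"
  using mult_right_mono[OF m_ge, of m] m_ge by (simp add: power2_eq_square)

lemma card_uncovered_6: "card (V - \<Union>M) = 6"
  using card_uncovered[OF tg M] six by simp

lemma card_link_ge: "v \<in> V \<Longrightarrow> 6 * m\<^sup>2 - 9/10000 * m\<^sup>2 \<le> real (card (link E v))"
proof -
  assume v: "v \<in> V"
  have "(3 * m)\<^sup>2 \<le> (real (card V))\<^sup>2" using six m_ge by (intro power_mono) (auto simp: m_def)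
  then have "(2/3 - 1/10000) * (9 * m\<^sup>2) \<le> (2/3 - 1/10000) * (real (card V))\<^sup>2"
    by (intro mult_left_mono) (simp_all add: power_mult_distrib)
  also have "\<dots> \<le> real (card (link E v))" using dense v by (simp add: link_dense_def)
  finally show ?thesis by (simp add: algebra_simps)
qed

lemma card_nontight_le:
  assumes Q: "card Q = 4" "Q \<subseteq> V - \<Union>M"
  shows "real (card (nontight E M Q)) \<le> m\<^sup>2 / 100"
proof -
  have "(\<Sum>v\<in>Q. card (link E v)) + card (nontight E M Q)
      \<le> 24 * (card M)\<^sup>2 + 9 * card Q * card M + 2 * card Q * card (V - \<Union>M) * card V"
    using Q by (intro link_sum_le nontight_subset sum_four_blocks_nontight) (auto simp: nontight_def)
  then have "real ((\<Sum>v\<in>Q. card (link E v)) + card (nontight E M Q))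
      \<le> real (24 * (card M)\<^sup>2 + 36 * card M + 48 * card V)"
    unfolding Q(1) card_uncovered_6 by (intro of_nat_mono) simp
  then have "(\<Sum>v\<in>Q. real (card (link E v))) + real (card (nontight E M Q)) \<le> 24 * m\<^sup>2 + 180 * m + 288"
    using six by (simp add: m_def)
  moreover have "(\<Sum>v\<in>Q. 6 * m\<^sup>2 - 9/10000 * m\<^sup>2) \<le> (\<Sum>v\<in>Q. real (card (link E v)))"
    using Q(2) by (intro sum_mono card_link_ge) blast
  moreover have "(\<Sum>v\<in>Q. 6 * m\<^sup>2 - 9/10000 * m\<^sup>2) = 24 * m\<^sup>2 - 36/10000 * m\<^sup>2"
    by (simp add: Q(1))
  ultimately show ?thesis using m_le_square m_ge by linarith
qed

text \<open>Exchanging \<open>v\<^sub>0, v\<^sub>1\<close> for a vertex \<open>u\<close> of the matching makes the bound for uncovered vertices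
  apply to \<open>u\<close>.\<close>

lemma card_nontight_exchanged_le:
  assumes ab: "a \<in> M" "b \<in> M" "a \<noteq> b" "r \<in> a"
    and v: "v0 \<noteq> v1" "{v0, v1} \<subseteq> V - \<Union>M" "misses_exactly E v0 r a b" "misses_exactly E v1 r a b"
    and u: "u = r \<or> u \<in> b" and Q: "card Q = 3" "Q \<subseteq> V - \<Union>M - {v0, v1}"
  shows "real (card (nontight E M (insert u Q))) \<le> m\<^sup>2 / 50"
proof -
  obtain s s' where a: "{r, s, s'} = a" "distinct [r, s, s']"
    by (rule triple_containing[OF card_edge[OF ab(1)] ab(4)])
  have "b \<noteq> {}" using card_edge[OF ab(2)] by auto
  then obtain t where t: "t \<in> b" "u = r \<or> u = t" using u by blast
  obtain t1 t2 where b: "{t, t1, t2} = b" by (rule triple_containing[OF card_edge[OF ab(2)] t(1)])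
  define M' where "M' = M - {a, b} \<union> {{v0, s, t1}, {v1, s', t2}}"
  have E: "{v0, s, t1} \<in> E" "{v1, s', t2} \<in> E"
    using v(3,4) a b unfolding misses_exactly_def by auto
  have "{v0, v1} \<inter> \<Union>M = {}" using v(2) by blast
  note sw = swap_two_edges[OF ab(1-3) a(1) b v(1) this E, folded M'_def]
  interpret swapped: near_perfect V E M'
    by unfold_locales (use tg sw stuck six large dense in simp_all)
  have "u \<in> \<Union>M" using t ab by auto
  then have "u \<in> V" "u \<notin> Q" "u \<notin> {v0, v1}" using matching_card_Union(2)[OF tg M] Q(2) v(2) by blast+
  moreover have "u \<notin> \<Union>M'" using sw(3) t(2) \<open>u \<notin> {v0, v1}\<close> by blast
  moreover have "Q \<inter> \<Union>M' = {}" using sw(3) Q(2) by auto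
  moreover have "finite Q" using Q(1) by (intro card_ge_0_finite) simp
  ultimately have "real (card (nontight E M' (insert u Q))) \<le> (real (card M))\<^sup>2 / 100"
    using swapped.card_nontight_le[of "insert u Q"] Q sw(2) by (auto simp: swapped.m_def)
  moreover have "M - M' \<subseteq> {a, b}" unfolding M'_def by blast
  then have "card (M - M') \<le> 2" using card_mono[of "{a, b}" "M - M'"] ab(3) by simp
  then have "2 * card (M - M') * card M \<le> 4 * card M" by simp
  then have "card (nontight E M (insert u Q)) \<le> card (nontight E M' (insert u Q)) + 4 * card M"
    using card_nontight_change[OF finite_M swapped.finite_M, of E "insert u Q"] by linarith
  then have "real (card (nontight E M (insert u Q))) \<le> real (card (nontight E M' (insert u Q))) + 4 * m"
    unfolding m_def using of_nat_mono by fastforce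
  ultimately show ?thesis using m_le_square m_ge unfolding m_def[symmetric] by linarith
qed

end

locale near_perfect_frame = near_perfect +
  fixes v0 v1 v2 v3 v4
  assumes v_distinct: "distinct [v0, v1, v2, v3, v4]"
    and v_uncovered: "{v0, v1, v2, v3, v4} \<subseteq> V - \<Union>M"
begin

definition arc :: "'a \<Rightarrow> 'a set \<Rightarrow> 'a set \<Rightarrow> bool" where
  "arc r g h \<longleftrightarrow> g \<in> M \<and> h \<in> M \<and> g \<noteq> h \<and> r \<in> g \<and> (\<forall>w\<in>{v0, v1, v2, v3}. misses_exactly E w r g h)"

definition arcs :: "('a set \<times> 'a set) set" where
  "arcs = {(g, h). \<exists>r. arc r g h}"

definition heads :: "'a set set" where
  "heads = snd ` arcs"

definition nontight_at :: "'a \<Rightarrow> ('a set \<times> 'a set) set" where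
  "nontight_at u = nontight E M {u, v2, v3, v4}"

definition exchangeable :: "'a \<Rightarrow> bool" where
  "exchangeable u \<longleftrightarrow> (\<exists>r g h. arc r g h \<and> (u = r \<or> u \<in> h))"

text \<open>If \<open>(g', g, h)\<close> is compatible, then no edge through the vertex \<open>r\<close> at which the arc \<open>(g, h)\<close> starts
  meets both \<open>g'\<close> and \<open>h\<close>, so that \<open>(g', h)\<close> is not tight for \<open>r\<close>. Counting compatible triples by
  \<open>g'\<close> and by \<open>g\<close> gives contradictory bounds.\<close>

definition compatible :: "('a set \<times> 'a set \<times> 'a set) set" where
  "compatible = (SIGMA g':heads. arcs - (\<Union>u\<in>g'. nontight_at u))"

lemma arcs_subset: "arcs \<subseteq> M \<times> M"
  by (auto simp: arcs_def arc_def)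

lemma finite_arcs: "finite arcs"
  by (rule finite_subset[OF arcs_subset]) (simp add: finite_M)

lemma heads_subset: "heads \<subseteq> M"
  using arcs_subset by (auto simp: heads_def)

lemma finite_heads: "finite heads"
  using heads_subset finite_M by (rule finite_subset)

lemma finite_nontight_at: "finite (nontight_at u)"
  by (simp add: nontight_at_def finite_nontight finite_M)

lemma card_nontight_at_le:
  assumes "exchangeable u"
  shows "real (card (nontight_at u)) \<le> m\<^sup>2 / 50"
proof -
  obtain r g h where "arc r g h" and u: "u = r \<or> u \<in> h"
    using assms by (auto simp: exchangeable_def)
  then have arc: "g \<in> M" "h \<in> M" "g \<noteq> h" "r \<in> g" "misses_exactly E v0 r g h" "misses_exactly E v1 r g h"
    by (simp_all add: arc_def)
  have v01: "v0 \<noteq> v1" "{v0, v1} \<subseteq> V - \<Union>M" using v_distinct v_uncovered by auto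
  have "card {v2, v3, v4} = 3" "{v2, v3, v4} \<subseteq> V - \<Union>M - {v0, v1}"
    using v_distinct v_uncovered by auto
  then show ?thesis
    unfolding nontight_at_def by (rule card_nontight_exchanged_le[OF arc(1-4) v01 arc(5,6) u])
qed

lemma card_UN_nontight_at_le:
  assumes "g \<in> M" "X \<subseteq> g" "\<And>u. u \<in> X \<Longrightarrow> exchangeable u"
  shows "real (card (\<Union>u\<in>X. nontight_at u)) \<le> 3 * (m\<^sup>2 / 50)"
proof -
  have X: "finite X" "card X \<le> 3"
    using assms(2) finite_edge[OF assms(1)] card_mono[of g X] card_edge[OF assms(1)]
    by (auto intro: finite_subset)
  then have "card (\<Union>u\<in>X. nontight_at u) \<le> (\<Sum>u\<in>X. card (nontight_at u))" by (intro card_UN_le)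
  then have "real (card (\<Union>u\<in>X. nontight_at u)) \<le> (\<Sum>u\<in>X. real (card (nontight_at u)))"
    unfolding of_nat_sum[symmetric] by (rule of_nat_mono)
  also have "\<dots> \<le> (\<Sum>u\<in>X. m\<^sup>2 / 50)" using assms(3) by (intro sum_mono card_nontight_at_le)
  also have "\<dots> \<le> 3 * (m\<^sup>2 / 50)" using X(2) by (simp add: mult_right_mono)
  finally show ?thesis .
qed

lemma card_arcs_ge: "49/100 * m\<^sup>2 \<le> real (card arcs)"
proof -
  let ?Q = "{v0, v1, v2, v3}"
  let ?D = "(\<lambda>g. (g, g)) ` M"
  have "M \<times> M \<subseteq> (arcs \<union> prod.swap ` arcs) \<union> (nontight E M ?Q \<union> ?D)"
  proof
    fix x assume "x \<in> M \<times> M"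
    then obtain g h where x: "x = (g, h)" "g \<in> M" "h \<in> M" by blast
    show "x \<in> (arcs \<union> prod.swap ` arcs) \<union> (nontight E M ?Q \<union> ?D)"
    proof (cases "g = h \<or> x \<in> nontight E M ?Q")
      case False
      then have "tight E ?Q g h" "g \<noteq> h" using x by (auto simp: nontight_def)
      then have "(g, h) \<in> arcs \<or> (h, g) \<in> arcs" unfolding tight_def arcs_def arc_def using x by blast
      then show ?thesis using x by force
    qed (use x in auto)
  qed
  then have "card (M \<times> M) \<le> card ((arcs \<union> prod.swap ` arcs) \<union> (nontight E M ?Q \<union> ?D))"
    using finite_arcs finite_M finite_nontight by (intro card_mono) auto
  also have "\<dots> \<le> (card arcs + card (prod.swap ` arcs)) + (card (nontight E M ?Q) + card ?D)"
    by (rule order_trans[OF card_Un_le add_mono[OF card_Un_le card_Un_le]])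
  finally have "card M * card M \<le> 2 * card arcs + card (nontight E M ?Q) + card M"
    using card_image_le[OF finite_arcs, of prod.swap] card_image_le[OF finite_M, of "\<lambda>g. (g, g)"]
    unfolding card_cartesian_product by linarith
  then have "real (card M * card M) \<le> real (2 * card arcs + card (nontight E M ?Q) + card M)"
    by (rule of_nat_mono)
  then have "m\<^sup>2 \<le> 2 * real (card arcs) + real (card (nontight E M ?Q)) + m"
    by (simp add: m_def power2_eq_square)
  moreover have "real (card (nontight E M ?Q)) \<le> m\<^sup>2 / 100"
    using v_distinct v_uncovered by (intro card_nontight_le) auto
  ultimately show ?thesis using m_le_square m_ge by linarith
qed

lemma card_heads_ge: "49/100 * m \<le> real (card heads)"
proof -
  have "arcs \<subseteq> M \<times> heads" using arcs_subset by (force simp: heads_def)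
  then have "card arcs \<le> card M * card heads"
    using card_mono[of "M \<times> heads" arcs] finite_M finite_heads by (simp add: card_cartesian_product)
  then have "real (card arcs) \<le> m * real (card heads)"
    unfolding m_def by (metis of_nat_le_iff of_nat_mult)
  then have "m * (49/100 * m) \<le> m * real (card heads)"
    using card_arcs_ge by (simp add: power2_eq_square)
  then show ?thesis using m_ge by simp
qed

lemma card_compatible_ge: "(49/100 * m) * (43/100 * m\<^sup>2) \<le> real (card compatible)"
proof -
  have fiber: "43/100 * m\<^sup>2 \<le> real (card (arcs - (\<Union>u\<in>g'. nontight_at u)))" if g': "g' \<in> heads" for g'
  proof -
    have "g' \<in> M" using g' heads_subset by blast
    moreover have "exchangeable u" if "u \<in> g'" for u
      using g' that unfolding heads_def arcs_def exchangeable_def by fastforce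
    ultimately have "real (card (\<Union>u\<in>g'. nontight_at u)) \<le> 3 * (m\<^sup>2 / 50)" by (rule card_UN_nontight_at_le[OF _ order_refl])
    moreover have "finite (\<Union>u\<in>g'. nontight_at u)" using finite_nontight_at finite_edge[OF \<open>g' \<in> M\<close>] by simp
    then have "card arcs - card (\<Union>u\<in>g'. nontight_at u) \<le> card (arcs - (\<Union>u\<in>g'. nontight_at u))"
      by (rule diff_card_le_card_Diff)
    then have "real (card arcs) \<le> real (card (\<Union>u\<in>g'. nontight_at u)) + real (card (arcs - (\<Union>u\<in>g'. nontight_at u)))"
      by linarith
    ultimately show ?thesis using card_arcs_ge by linarith
  qed
  have "(49/100 * m) * (43/100 * m\<^sup>2) \<le> real (card heads) * (43/100 * m\<^sup>2)"
    using card_heads_ge by (intro mult_right_mono) auto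
  also have "\<dots> = (\<Sum>g'\<in>heads. 43/100 * m\<^sup>2)" by simp
  also have "\<dots> \<le> (\<Sum>g'\<in>heads. real (card (arcs - (\<Union>u\<in>g'. nontight_at u))))" by (intro sum_mono fiber)
  also have "\<dots> = real (card compatible)"
    unfolding compatible_def using finite_heads finite_arcs by (subst card_SigmaI) auto
  finally show ?thesis .
qed

lemma compatible_missing_edge:
  assumes arc: "arc r g h" and nb: "\<And>u. u \<in> g' \<Longrightarrow> (g, h) \<notin> nontight_at u" and ut: "u \<in> g'" "t \<in> h"
  shows "{r, u, t} \<notin> E"
proof -
  have gh: "g \<in> M" "h \<in> M" "g \<noteq> h" "r \<in> g" "misses_exactly E v2 r g h"
    using arc by (auto simp: arc_def)
  have "h \<noteq> {}" using ut(2) by blast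
  have "tight E {u, v2, v3, v4} g h" using nb[OF ut(1)] gh by (simp add: nontight_at_def nontight_def)
  then consider r' where "r' \<in> g" "misses_exactly E u r' g h" "misses_exactly E v2 r' g h"
    | r' where "r' \<in> h" "misses_exactly E v2 r' h g"
    unfolding tight_def by blast
  then have "misses_exactly E u r g h"
  proof cases
    case 1
    then show ?thesis using misses_exactly_unique[OF gh(5) 1(3) gh(4) \<open>h \<noteq> {}\<close>] by simp
  next
    case 2
    then show ?thesis using not_misses_exactly_both[OF gh(5) _ card_edge[OF gh(1)] gh(4)] by blast
  qed
  then have "{u, r, t} \<notin> E" using gh(4) ut(2) by (auto simp: misses_exactly_def)
  then show ?thesis by (simp add: insert_commute)
qed

lemma compatible_nontight:
  assumes arc: "arc r g h" and nb: "\<And>u. u \<in> g' \<Longrightarrow> (g, h) \<notin> nontight_at u" and g': "g' \<in> M" "g' \<noteq> h"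
  shows "(g', h) \<in> nontight_at r"
proof (rule ccontr)
  have h: "h \<in> M" using arc by (simp add: arc_def)
  have ne: "g' \<noteq> {}" "h \<noteq> {}" using card_edge[OF g'(1)] card_edge[OF h] by auto
  have none: "{r, u, t} \<notin> E" if "u \<in> g'" "t \<in> h" for u t
    using compatible_missing_edge[OF arc _ that] nb by blast
  assume "(g', h) \<notin> nontight_at r"
  then have "tight E {r, v2, v3, v4} g' h" using g' h by (simp add: nontight_at_def nontight_def)
  then consider r' where "r' \<in> g'" "misses_exactly E r r' g' h" | r' where "r' \<in> h" "misses_exactly E r r' h g'"
    unfolding tight_def by blast
  then show False
  proof cases
    case 1
    then obtain p q where "p \<in> g'" "q \<in> h" "{r, p, q} \<in> E"
      using misses_exactly_edge[OF 1(2) card_edge[OF g'(1)] 1(1) ne(2)] by blast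
    then show False using none by blast
  next
    case 2
    then obtain p q where "p \<in> h" "q \<in> g'" "{r, p, q} \<in> E"
      using misses_exactly_edge[OF 2(2) card_edge[OF h] 2(1) ne(1)] by blast
    then show False using none[of q p] by (simp add: insert_commute)
  qed
qed

lemma card_compatible_le: "real (card compatible) \<le> m * (7/100 * m\<^sup>2)"
proof -
  define D where "D g = (\<Union>r\<in>{r \<in> g. \<exists>h. arc r g h}. nontight_at r) \<union> (\<lambda>h. (h, h)) ` M" for g
  let ?f = "\<lambda>(g', g, h). (g :: 'a set, g' :: 'a set, h :: 'a set)"
  have "?f ` compatible \<subseteq> (SIGMA g:M. D g)"
  proof
    fix y assume "y \<in> ?f ` compatible"
    then obtain g' g h where y: "y = (g, g', h)" and comp: "(g', g, h) \<in> compatible" by auto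
    then have g': "g' \<in> M" and nb: "\<And>u. u \<in> g' \<Longrightarrow> (g, h) \<notin> nontight_at u"
      using heads_subset by (auto simp: compatible_def)
    obtain r where r: "arc r g h" using comp by (auto simp: compatible_def arcs_def)
    then have "r \<in> g" "g \<in> M" by (simp_all add: arc_def)
    moreover have "(g', h) \<in> D g"
      using compatible_nontight[OF r nb g'] r g' \<open>r \<in> g\<close> by (cases "g' = h") (auto simp: D_def)
    ultimately show "y \<in> (SIGMA g:M. D g)" using y by simp
  qed
  moreover have fin: "finite (D g)" if "g \<in> M" for g
    using finite_edge[OF that] finite_nontight_at finite_M by (simp add: D_def)
  ultimately have "card (?f ` compatible) \<le> card (SIGMA g:M. D g)"
    using finite_M by (intro card_mono) auto
  also have "\<dots> = (\<Sum>g\<in>M. card (D g))" using finite_M fin by (intro card_SigmaI) auto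
  also have "card (?f ` compatible) = card compatible" by (rule card_image) (auto simp: inj_on_def)
  finally have "real (card compatible) \<le> (\<Sum>g\<in>M. real (card (D g)))"
    unfolding of_nat_sum[symmetric] by (rule of_nat_mono)
  also have "\<dots> \<le> (\<Sum>g\<in>M. 7/100 * m\<^sup>2)"
  proof (rule sum_mono)
    fix g assume g: "g \<in> M"
    let ?B = "\<Union>r\<in>{r \<in> g. \<exists>h. arc r g h}. nontight_at r"
    have "card (D g) \<le> card ?B + card M"
      unfolding D_def using card_image_le[OF finite_M] by (intro order_trans[OF card_Un_le add_left_mono])
    then have "real (card (D g)) \<le> real (card ?B) + m" by (simp add: m_def)
    moreover have "real (card ?B) \<le> 3 * (m\<^sup>2 / 50)"
      by (rule card_UN_nontight_at_le[OF g]) (auto simp: exchangeable_def)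
    ultimately show "real (card (D g)) \<le> 7/100 * m\<^sup>2" using m_le_square m_ge by linarith
  qed
  finally show ?thesis by (simp add: m_def)
qed

lemma frame_contradiction: False
proof -
  have "(49/100 * m) * (43/100 * m\<^sup>2) \<le> m * (7/100 * m\<^sup>2)"
    using card_compatible_ge card_compatible_le by linarith
  then have "m * m\<^sup>2 * (49/100 * (43/100)) \<le> m * m\<^sup>2 * (7/100)" by (simp add: algebra_simps)
  then show False using m_ge by simp
qed

end

context near_perfect
begin

lemma contradiction: False
proof -
  have "5 \<le> card (V - \<Union>M)" using card_uncovered_6 by simp
  then obtain T where T: "T \<subseteq> V - \<Union>M" "card T = 5" "finite T" by (rule obtain_subset_with_card_n)
  then obtain vs where vs: "set vs = T" "distinct vs" using finite_distinct_list by blast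
  then have "length vs = 5" using distinct_card[of vs] T(2) by simp
  then obtain v0 v1 v2 v3 v4 where "vs = [v0, v1, v2, v3, v4]"
    by (auto simp: numeral_eq_Suc length_Suc_conv)
  then have "distinct [v0, v1, v2, v3, v4]" "{v0, v1, v2, v3, v4} \<subseteq> V - \<Union>M"
    using vs T(1) by auto
  then interpret near_perfect_frame V E M v0 v1 v2 v3 v4
    by unfold_locales
  show False by (rule frame_contradiction)
qed

end

section \<open>Edge-maximal hypergraphs and star matchings\<close>

definition triples :: "'a set \<Rightarrow> 'a set set" where
  "triples V = {e. e \<subseteq> V \<and> card e = 3}"

lemma three_graph_triples: "finite V \<Longrightarrow> three_graph V (triples V)"
  by (simp add: three_graph_def triples_def)

lemma three_graph_iff: "three_graph V E \<longleftrightarrow> finite V \<and> E \<subseteq> triples V"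
  by (auto simp: three_graph_def triples_def)

lemma edge_maximal_supergraph:
  assumes tg: "three_graph V C" and "E \<subseteq> C" and no: "\<nexists>M. matching E M \<and> card M = k"
  obtains F where "E \<subseteq> F" "F \<subseteq> C" "\<nexists>M. matching F M \<and> card M = k"
    "\<And>e. e \<in> C - F \<Longrightarrow> \<exists>M. matching F M \<and> Suc (card M) = k \<and> e \<inter> \<Union>M = {}"
proof -
  let ?P = "{F. E \<subseteq> F \<and> F \<subseteq> C \<and> (\<nexists>M. matching F M \<and> card M = k)}"
  have "finite ?P"
    by (rule finite_subset[of _ "Pow C"]) (use three_graph_finite[OF tg] in auto)
  moreover have "E \<in> ?P" using assms(2) no by simp
  ultimately obtain F where "F \<in> ?P" and max: "\<forall>F'\<in>?P. F \<subseteq> F' \<longrightarrow> F = F'"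
    using finite_has_maximal2[of ?P E] by meson
  then have F: "E \<subseteq> F" "F \<subseteq> C" "\<nexists>M. matching F M \<and> card M = k" by simp_all
  have "\<exists>M. matching F M \<and> Suc (card M) = k \<and> e \<inter> \<Union>M = {}" if e: "e \<in> C - F" for e
  proof -
    have "insert e F \<notin> ?P"
    proof
      assume "insert e F \<in> ?P"
      then have "F = insert e F" using max by (meson subset_insertI)
      then show False using e by blast
    qed
    then obtain M where M: "matching (insert e F) M" "card M = k" using F(1,2) e by blast
    have "e \<in> M"
    proof (rule ccontr)
      assume "e \<notin> M"
      then have "matching F M" using M(1) by (auto simp: matching_def)
      then show False using F(3) M(2) by blast
    qed
    have "three_graph V (insert e F)" using three_graph_subset[OF tg] F(2) e by simp
    then have "finite M" using M(1) by (rule matching_finite)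
    then have "Suc (card (M - {e})) = k" using card_Suc_Diff1[of M e] \<open>e \<in> M\<close> M(2) by simp
    moreover have "matching F (M - {e})"
      using matching_subset[OF M(1), of "M - {e}"] by (auto simp: matching_def)
    moreover have "e \<inter> \<Union>(M - {e}) = {}"
      using matching_Union_Diff[OF M(1), of "{e}"] \<open>e \<in> M\<close> by auto
    ultimately show ?thesis by blast
  qed
  then show ?thesis by (rule that[OF F])
qed

lemma star_matching:
  assumes "inj_on r Z" "inj_on s Z" "Z \<inter> r ` Z = {}" "Z \<inter> s ` Z = {}" "r ` Z \<inter> s ` Z = {}"
    and E: "\<And>z. z \<in> Z \<Longrightarrow> {z, r z, s z} \<in> E"
  defines "M \<equiv> (\<lambda>z. {z, r z, s z}) ` Z"
  shows "matching E M" "card M = card Z" "\<Union>M = Z \<union> r ` Z \<union> s ` Z"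
proof -
  have dis: "{z, r z, s z} \<inter> {z', r z', s z'} = {}" if "z \<in> Z" "z' \<in> Z" "z \<noteq> z'" for z z'
  proof -
    have "r z \<noteq> r z'" "s z \<noteq> s z'" using that assms(1,2) inj_on_eq_iff by metis+
    moreover have "z \<noteq> r z'" "z' \<noteq> r z" "z \<noteq> s z'" "z' \<noteq> s z" "r z \<noteq> s z'" "r z' \<noteq> s z"
      using that(1,2) assms(3-5) by blast+
    ultimately show ?thesis using that(3) by simp
  qed
  then have "inj_on (\<lambda>z. {z, r z, s z}) Z"
    by (intro inj_onI) blast
  then show "card M = card Z" unfolding M_def by (rule card_image)
  have "disjoint M"
    unfolding M_def using dis by (intro pairwise_imageI) (simp add: disjnt_def)
  then show "matching E M" using E by (auto simp: matching_def M_def)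
  show "\<Union>M = Z \<union> r ` Z \<union> s ` Z" unfolding M_def by blast
qed

lemma star_matching_extend:
  assumes fin: "finite Z" "finite Y" and ZY: "Z \<inter> Y = {}" "card Y = 2 * card Z"
    and r: "inj_on r Z" "r ` Z \<subseteq> Y"
    and E: "\<And>z y. z \<in> Z \<Longrightarrow> y \<in> Y - r ` Z \<Longrightarrow> {z, r z, y} \<in> E"
  obtains M where "matching E M" "card M = card Z" "\<Union>M = Z \<union> Y"
proof -
  have "card (Y - r ` Z) = card Z" using fin r ZY by (simp add: card_Diff_subset card_image)
  then obtain s where "bij_betw s Z (Y - r ` Z)"
    using finite_same_card_bij[of Z "Y - r ` Z"] fin by auto
  then have s: "inj_on s Z" "s ` Z = Y - r ` Z" by (auto simp: bij_betw_def)
  have "Z \<inter> r ` Z = {}" "Z \<inter> s ` Z = {}" "r ` Z \<inter> s ` Z = {}" using s r ZY by auto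
  moreover have "{z, r z, s z} \<in> E" if "z \<in> Z" for z using E that s by auto
  ultimately have "matching E ((\<lambda>z. {z, r z, s z}) ` Z)" "card ((\<lambda>z. {z, r z, s z}) ` Z) = card Z"
      "\<Union>((\<lambda>z. {z, r z, s z}) ` Z) = Z \<union> r ` Z \<union> s ` Z"
    using star_matching[of r Z s E] r(1) s(1) by simp_all
  moreover have "Z \<union> r ` Z \<union> s ` Z = Z \<union> Y" using s(2) r(2) by auto
  ultimately show ?thesis using that by metis
qed

lemma injective_choice:
  assumes "finite W" "\<And>w. w \<in> W \<Longrightarrow> card W \<le> card (A w)"
  shows "\<exists>r. inj_on r W \<and> (\<forall>w\<in>W. r w \<in> A w)"
  using assms
proof (induction W rule: finite_induct)
  case empty
  then show ?case by simp
next
  case (insert x X)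
  have "card X \<le> card (A w)" if "w \<in> X" for w
    using insert.prems[of w] insert.hyps that by simp
  then obtain r where r: "inj_on r X" "\<forall>w\<in>X. r w \<in> A w" using insert.IH by blast
  have "card (r ` X) < card (A x)"
    using card_image_le[OF insert.hyps(1), of r] insert.prems[of x] insert.hyps by simp
  then obtain y where y: "y \<in> A x" "y \<notin> r ` X"
    using card_mono[of "r ` X" "A x"] insert.hyps(1) by (meson finite_imageI leD subsetI)
  have "inj_on (r(x := y)) (insert x X)"
    using r(1) y(2) insert.hyps(2) by (auto simp: inj_on_def)
  moreover have "\<forall>w\<in>insert x X. (r(x := y)) w \<in> A w" using r(2) y(1) by auto
  ultimately show ?case by blast
qed

lemma injective_extend:
  assumes "finite Y" "finite B" "inj_on r W" "r ` W \<subseteq> Y" "W \<inter> B = {}" "card (r ` W) + card B \<le> card Y"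
  obtains r' where "inj_on r' (W \<union> B)" "r' ` (W \<union> B) \<subseteq> Y" "\<And>w. w \<in> W \<Longrightarrow> r' w = r w"
proof -
  have "finite (r ` W)" using assms(4,1) by (rule finite_subset)
  then have "card B \<le> card (Y - r ` W)" using assms(1,4,6) by (simp add: card_Diff_subset)
  then obtain g where g: "g ` B \<subseteq> Y - r ` W" "inj_on g B" using card_le_inj[of B "Y - r ` W"] assms(1,2) by auto
  let ?r = "\<lambda>z. if z \<in> W then r z else g z"
  have gB: "?r z = g z" if "z \<in> B" for z using that assms(5) by auto
  have "inj_on ?r W" using assms(3) by (simp add: inj_on_def)
  moreover have "inj_on ?r B" using g(2) gB by (simp add: inj_on_def)
  moreover have im: "?r ` W = r ` W" "?r ` B = g ` B" using gB by auto
  ultimately have "inj_on ?r (W \<union> B)" unfolding inj_on_Un using g(1) by auto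
  moreover have "?r ` (W \<union> B) \<subseteq> Y" unfolding image_Un im using g(1) assms(4) by auto
  ultimately show ?thesis by (rule that) simp
qed

lemma star_matching_prescribed:
  assumes fin: "finite W" "finite B" "finite Y" and disj: "W \<inter> B = {}" "(W \<union> B) \<inter> Y = {}"
    and cY: "card Y = 2 * card (W \<union> B)"
    and A: "\<And>w. w \<in> W \<Longrightarrow> A w \<subseteq> Y" "\<And>w. w \<in> W \<Longrightarrow> card W \<le> card (A w)"
    and EW: "\<And>w u y. w \<in> W \<Longrightarrow> u \<in> A w \<Longrightarrow> y \<in> Y \<Longrightarrow> u \<noteq> y \<Longrightarrow> {w, u, y} \<in> E"
    and EB: "\<And>b y y'. b \<in> B \<Longrightarrow> y \<in> Y \<Longrightarrow> y' \<in> Y \<Longrightarrow> y \<noteq> y' \<Longrightarrow> {b, y, y'} \<in> E"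
  obtains M where "matching E M" "card M = card (W \<union> B)" "\<Union>M = W \<union> B \<union> Y"
proof -
  obtain r where r: "inj_on r W" "\<forall>w\<in>W. r w \<in> A w"
    using injective_choice[OF fin(1), of A] A(2) by blast
  have rY: "r ` W \<subseteq> Y" using r(2) A(1) by blast
  have "card (r ` W) + card B \<le> card Y"
    using card_image[OF r(1)] fin disj(1) cY by (simp add: card_Un_disjoint)
  then obtain r' where r': "inj_on r' (W \<union> B)" "r' ` (W \<union> B) \<subseteq> Y" "\<And>w. w \<in> W \<Longrightarrow> r' w = r w"
    by (rule injective_extend[OF fin(3,2) r(1) rY disj(1)]) blast
  have "finite (W \<union> B)" using fin by simp
  then show ?thesis
  proof (rule star_matching_extend[OF _ fin(3) disj(2) cY r'(1,2), of E])
    fix z y assume z: "z \<in> W \<union> B" and y: "y \<in> Y - r' ` (W \<union> B)"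
    then have "r' z \<in> Y" "y \<in> Y" "r' z \<noteq> y" using r'(2) by auto
    then show "{z, r' z, y} \<in> E" using z r(2) r'(3) EW EB by (cases "z \<in> W") auto
  qed (rule that)
qed

corollary complete_star_matching:
  assumes "finite Z" "finite Y" "Z \<inter> Y = {}" "card Y = 2 * card Z"
    and "\<And>z y y'. z \<in> Z \<Longrightarrow> y \<in> Y \<Longrightarrow> y' \<in> Y \<Longrightarrow> y \<noteq> y' \<Longrightarrow> {z, y, y'} \<in> E"
  obtains M where "matching E M" "card M = card Z" "\<Union>M = Z \<union> Y"
  by (rule star_matching_prescribed[of "{}" Z Y "\<lambda>_. {}" E]) (use assms that in auto)

lemma triples_matching:
  assumes "finite V" "3 * k \<le> card V"
  shows "\<exists>M. matching (triples V) M \<and> card M = k"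
proof -
  have "k \<le> card V" using assms(2) by linarith
  then obtain Z where Z: "Z \<subseteq> V" "card Z = k" "finite Z" by (rule obtain_subset_with_card_n)
  have "2 * k \<le> card (V - Z)" using assms Z by (simp add: card_Diff_subset)
  then obtain Y where Y: "Y \<subseteq> V - Z" "card Y = 2 * k" "finite Y" by (rule obtain_subset_with_card_n)
  have "Z \<inter> Y = {}" "card Y = 2 * card Z" using Z Y by auto
  moreover have "{z, y, y'} \<in> triples V" if "z \<in> Z" "y \<in> Y" "y' \<in> Y" "y \<noteq> y'" for z y y'
    using that Z Y by (auto simp: triples_def card_triple_iff)
  ultimately obtain M where "matching (triples V) M" "card M = card Z"
    using complete_star_matching[OF Z(3) Y(3)] by metis
  then show ?thesis using Z(2) by auto
qed

theorem near_perfect_matching: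
  assumes tg: "three_graph V E" and dv: "3 dvd card V" and large: "card V \<ge> 90006"
    and dense: "link_dense (2/3 - 1/10000) V E"
  shows "\<exists>M. matching E M \<and> 3 * card M + 3 = card V"
proof (rule ccontr)
  assume contra: "\<not> ?thesis"
  obtain q where q: "card V = 3 * q" using dv by blast
  have fin: "finite V" by (rule three_graph_finite_vertices[OF tg])
  have no: "\<nexists>M. matching E M \<and> card M = q - 1" using contra q large by auto
  have "E \<subseteq> triples V" using tg by (simp add: three_graph_iff)
  then obtain F where F: "E \<subseteq> F" "F \<subseteq> triples V" and noF: "\<nexists>M. matching F M \<and> card M = q - 1"
    and max: "\<And>e. e \<in> triples V - F \<Longrightarrow> \<exists>M. matching F M \<and> Suc (card M) = q - 1 \<and> e \<inter> \<Union>M = {}"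
    by (rule edge_maximal_supergraph[OF three_graph_triples[OF fin] _ no]) blast
  have "F \<noteq> triples V" using triples_matching[OF fin, of "q - 1"] noF q by fastforce
  then obtain M where M: "matching F M" "Suc (card M) = q - 1" using F(2) max by blast
  have tgF: "three_graph V F" using F(2) fin by (simp add: three_graph_iff)
  have "stuck_matching V F M" using tgF M noF by unfold_locales auto
  moreover have "card V = 3 * card M + 6" "30000 \<le> card M" using M(2) q large by auto
  ultimately interpret near_perfect V F M
    using link_dense_mono[OF tgF F(1) dense] by (intro near_perfect.intro near_perfect_axioms.intro)
  show False by (rule contradiction)
qed

section \<open>Absorption\<close>

text \<open>Triples that repeat a vertex or meet \<open>N\<close> count as absorbed, since they never have to be.\<close>

definition absorbs :: "'a set set \<Rightarrow> 'a set set \<Rightarrow> 'a set \<Rightarrow> bool" where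
  "absorbs E N X \<longleftrightarrow> (card X = 3 \<and> X \<inter> \<Union>N = {} \<longrightarrow>
     (\<exists>N'. matching E N' \<and> \<Union>N' = \<Union>N \<union> X))"

definition unabsorbed :: "'a set \<Rightarrow> 'a set set \<Rightarrow> 'a set set \<Rightarrow> ('a \<times> 'a \<times> 'a) set" where
  "unabsorbed V E R = {(x, y, z) \<in> V \<times> V \<times> V. \<forall>N\<subseteq>R. \<not> absorbs E N {x, y, z}}"

lemma absorbs_gadget:
  assumes tg: "three_graph V E" and dist: "distinct [a, b, c, p, p', q, q', r, r']"
    and E: "{a, b, c} \<in> E" "{x, p, p'} \<in> E" "{y, q, q'} \<in> E" "{z, r, r'} \<in> E"
  shows "absorbs E {{a, p, p'}, {b, q, q'}, {c, r, r'}} {x, y, z}"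
  unfolding absorbs_def
proof
  let ?N = "{{a, p, p'}, {b, q, q'}, {c, r, r'}}" and ?N' = "{{x, p, p'}, {y, q, q'}, {z, r, r'}}"
  assume "card {x, y, z} = 3 \<and> {x, y, z} \<inter> \<Union>?N = {}"
  then have xyz: "distinct [x, y, z]" "{x, y, z} \<inter> {a, b, c, p, p', q, q', r, r'} = {}"
    by (auto simp: card_triple_iff)
  then have "matching E ?N'"
    using dist by (intro matching_three_edges(1)[OF tg E(2-4)]) auto
  moreover have "\<Union>{{a, b, c}} \<inter> \<Union>?N' = {}" using dist xyz by auto
  ultimately have "matching E ({{a, b, c}} \<union> ?N')"
    by (intro matching_Un(1)[OF tg matching_singleton[OF E(1)]])
  moreover have "\<Union>({{a, b, c}} \<union> ?N') = \<Union>?N \<union> {x, y, z}" by auto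
  ultimately show "\<exists>N'. matching E N' \<and> \<Union>N' = \<Union>?N \<union> {x, y, z}" by blast
qed

lemma perfect_matching_if_absorbs:
  assumes tg: "three_graph V E" and M: "matching E M" and N: "N \<subseteq> M"
    and "card (V - \<Union>M) = 3" "absorbs E N (V - \<Union>M)"
  shows "\<exists>M'. perfect_matching V E M'"
proof -
  have "(V - \<Union>M) \<inter> \<Union>N = {}" using N by blast
  then obtain N' where N': "matching E N'" "\<Union>N' = \<Union>N \<union> (V - \<Union>M)"
    using assms(4,5) by (auto simp: absorbs_def)
  then have "\<Union>N' \<inter> \<Union>M \<subseteq> \<Union>N" by blast
  note rep = matching_replace[OF tg M N N'(1) this]
  have "\<Union>(M - N \<union> N') = V" using rep(3) N'(2) N matching_card_Union(2)[OF tg M] by blast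
  then have "perfect_matching V E (M - N \<union> N')"
    using rep(1) by (simp add: perfect_matching_def matching_def)
  then show ?thesis by (rule exI)
qed

lemma averaging:
  fixes d :: nat
  assumes fin: "finite I" "finite K" and K: "K \<noteq> {}"
    and many: "\<And>i. i \<in> I \<Longrightarrow> card K \<le> d * card {k \<in> K. R i k}"
  obtains k where "k \<in> K" "card I \<le> d * card {i \<in> I. R i k}"
proof -
  have "\<exists>k\<in>K. card I \<le> d * card {i \<in> I. R i k}"
  proof (rule ccontr)
    assume "\<not> ?thesis"
    then have "(\<Sum>k\<in>K. d * card {i \<in> I. R i k}) < (\<Sum>k\<in>K. card I)"
      using fin K by (intro sum_strict_mono) (auto simp: not_le)
    also have "\<dots> = (\<Sum>i\<in>I. card K)" by simp
    also have "\<dots> \<le> (\<Sum>i\<in>I. d * card {k \<in> K. R i k})" using many by (rule sum_mono)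
    also have "\<dots> = (\<Sum>k\<in>K. d * card {i \<in> I. R i k})"
      using sum_multicount_gen[OF fin(2,1), of "\<lambda>k i. R i k" "\<lambda>i. card {k \<in> K. R i k}"]
      by (simp flip: sum_distrib_left)
    finally show False by simp
  qed
  then show ?thesis using that by blast
qed

locale dense_graph = three_uniform +
  assumes nonempty: "V \<noteq> {}"
    and dense: "link_dense (2/3 - 1/20000) V E"
begin

lemma many_common_pairs:
  assumes a: "a \<in> V" and x: "x \<in> V" and F: "F \<subseteq> V" "100 * card F \<le> card V"
  shows "(card V)\<^sup>2 \<le> 4 * card (link E a \<inter> link E x \<inter> (V - F) \<times> (V - F))"
proof -
  define n where "n = real (card V)"
  let ?K = "link E a \<inter> link E x \<inter> (V - F) \<times> (V - F)"
  note fin = finite_link[OF tg]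
  have "card (link E a \<inter> link E x) \<le> card ?K + 2 * card F * card V"
    using link_subset[OF tg, of a] F(1) finite_V fin
    by (intro card_le_add_cross) (auto intro: finite_subset)
  moreover have "card (link E a) + card (link E x) = card (link E a \<union> link E x) + card (link E a \<inter> link E x)"
    by (rule card_Un_Int[OF fin fin])
  moreover have "card (link E a \<union> link E x) \<le> card (V \<times> V)"
    using finite_V link_subset[OF tg] by (intro card_mono) auto
  ultimately have "card (link E a) + card (link E x) \<le> (card V)\<^sup>2 + card ?K + 2 * card F * card V"
    by (simp add: card_cartesian_product power2_eq_square)
  then have "real (card (link E a) + card (link E x)) \<le> real ((card V)\<^sup>2 + card ?K + 2 * card F * card V)"
    by (rule of_nat_mono)
  then have "real (card (link E a)) + real (card (link E x)) \<le> n\<^sup>2 + real (card ?K) + 2 * (real (card F) * n)"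
    by (simp add: n_def)
  moreover have "100 * (real (card F) * n) \<le> n\<^sup>2"
    using mult_right_mono[of "100 * real (card F)" n n] F(2) by (simp add: n_def power2_eq_square)
  moreover have "(2/3 - 1/20000) * n\<^sup>2 \<le> real (card (link E v))" if "v \<in> V" for v
    using dense that by (simp add: link_dense_def n_def)
  note this[OF a] this[OF x]
  moreover have "0 \<le> n\<^sup>2" by simp
  ultimately have "n\<^sup>2 \<le> 4 * real (card ?K)" by (simp add: field_simps)
  then have "real ((card V)\<^sup>2) \<le> real (4 * card ?K)" by (simp add: n_def)
  then show ?thesis by (rule of_nat_le_iff[THEN iffD1])
qed

lemma pick_pair:
  assumes I: "finite I" and x: "\<And>i. i \<in> I \<Longrightarrow> x i \<in> V" and a: "a \<in> V"
    and F: "F \<subseteq> V" "100 * card F \<le> card V"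
  obtains p q J where "p \<in> V - F" "q \<in> V - F" "{a, p, q} \<in> E"
    "J \<subseteq> I" "card I \<le> 4 * card J" "\<And>i. i \<in> J \<Longrightarrow> {x i, p, q} \<in> E"
proof -
  let ?K = "link E a \<inter> (V - F) \<times> (V - F)"
  have finK: "finite ?K" using finite_link[OF tg] by simp
  have "card ?K \<le> (card V)\<^sup>2"
    using card_mono[of "link E a" ?K] finite_link[OF tg] card_link_le[OF tg, of a] by fastforce
  moreover have "(card V)\<^sup>2 \<le> 4 * card {k \<in> ?K. k \<in> link E (x i)}" if "i \<in> I" for i
  proof -
    have "{k \<in> ?K. k \<in> link E (x i)} = link E a \<inter> link E (x i) \<inter> (V - F) \<times> (V - F)" by auto
    then show ?thesis using many_common_pairs[OF a x[OF that] F] by simp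
  qed
  ultimately have "card ?K \<le> 4 * card {k \<in> ?K. k \<in> link E (x i)}" if "i \<in> I" for i
    using that order_trans by blast
  moreover have "?K \<noteq> {}"
    using many_common_pairs[OF a a F] nonempty finite_V by auto
  ultimately obtain k where k: "k \<in> ?K" "card I \<le> 4 * card {i \<in> I. k \<in> link E (x i)}"
    using averaging[OF I finK, of 4 "\<lambda>i k. k \<in> link E (x i)"] by blast
  obtain p q where pq: "k = (p, q)" by (cases k)
  show ?thesis
  proof (rule that)
    show "p \<in> V - F" "q \<in> V - F" "{a, p, q} \<in> E" using k(1) pq by auto
    show "card I \<le> 4 * card {i \<in> I. {x i, p, q} \<in> E}" using k(2) pq by simp
  qed auto
qed

lemma edge_outside:
  assumes F: "F \<subseteq> V" "100 * card F \<le> card V"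
  obtains a b c where "{a, b, c} \<in> E" "{a, b, c} \<inter> F = {}"
proof -
  have "0 < card V" using nonempty finite_V by (simp add: card_gt_0_iff)
  then have "card F < card V" using F(2) by linarith
  then obtain a where a: "a \<in> V" "a \<notin> F"
    using card_mono[of F V] finite_subset[OF F(1) finite_V] by (meson leD subsetI)
  obtain b c where "b \<in> V - F" "c \<in> V - F" "{a, b, c} \<in> E"
    by (rule pick_pair[of "{}" "\<lambda>_. a" a F]) (use F a in auto)
  then show ?thesis using that[of a b c] a(2) by simp
qed

lemma pick_three_pairs:
  assumes T: "T \<subseteq> V \<times> V \<times> V" and F: "F \<subseteq> V" "100 * (card F + 7) \<le> card V"
    and abc: "{a, b, c} \<in> E"
  obtains p p' q q' r r' J where "distinct [a, b, c, p, p', q, q', r, r']" "{p, p', q, q', r, r'} \<inter> F = {}"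
    "{a, p, p'} \<in> E" "{b, q, q'} \<in> E" "{c, r, r'} \<in> E" "J \<subseteq> T" "card T \<le> 64 * card J"
    "\<And>x y z. (x, y, z) \<in> J \<Longrightarrow> {x, p, p'} \<in> E \<and> {y, q, q'} \<in> E \<and> {z, r, r'} \<in> E"
proof -
  have room: "F \<union> set xs \<subseteq> V \<and> 100 * card (F \<union> set xs) \<le> card V" if "set xs \<subseteq> V" "length xs \<le> 7" for xs
    using card_Un_le[of F "set xs"] card_length[of xs] that F by simp
  have finT: "finite T" using finite_subset[OF T] finite_V by simp
  note V = three_graph_edge[OF tg abc]
  let ?F1 = "F \<union> set [a, b, c]"
  obtain p p' T1 where p: "p \<in> V - ?F1" "p' \<in> V - ?F1" "{a, p, p'} \<in> E"
    and T1: "T1 \<subseteq> T" "card T \<le> 4 * card T1" "\<And>i. i \<in> T1 \<Longrightarrow> {fst i, p, p'} \<in> E"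
    by (rule pick_pair[OF finT _ V(2), of fst ?F1]) (use T V room[of "[a, b, c]"] in auto)
  let ?F2 = "F \<union> set [a, b, c, p, p']"
  obtain q q' T2 where q: "q \<in> V - ?F2" "q' \<in> V - ?F2" "{b, q, q'} \<in> E"
    and T2: "T2 \<subseteq> T1" "card T1 \<le> 4 * card T2" "\<And>i. i \<in> T2 \<Longrightarrow> {fst (snd i), q, q'} \<in> E"
    by (rule pick_pair[OF finite_subset[OF T1(1) finT] _ V(3), of "fst \<circ> snd" ?F2])
      (use T T1(1) V p room[of "[a, b, c, p, p']"] in auto)
  have T2V: "T2 \<subseteq> V \<times> V \<times> V" and finT2: "finite T2"
    using T1(1) T2(1) T finite_subset[OF _ finT, of T2] by blast+
  let ?F3 = "F \<union> set [a, b, c, p, p', q, q']"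
  obtain r r' T3 where r: "r \<in> V - ?F3" "r' \<in> V - ?F3" "{c, r, r'} \<in> E"
    and T3: "T3 \<subseteq> T2" "card T2 \<le> 4 * card T3" "\<And>i. i \<in> T3 \<Longrightarrow> {snd (snd i), r, r'} \<in> E"
    by (rule pick_pair[OF finT2 _ V(4), of "snd \<circ> snd" ?F3])
      (use T2V V p q room[of "[a, b, c, p, p', q, q']"] in auto)
  show ?thesis
  proof (rule that[OF _ _ p(3) q(3) r(3)])
    show "distinct [a, b, c, p, p', q, q', r, r']"
      using V(1) three_graph_edge(1)[OF tg p(3)] three_graph_edge(1)[OF tg q(3)] three_graph_edge(1)[OF tg r(3)]
        p(1,2) q(1,2) r(1,2) by auto
    show "{p, p', q, q', r, r'} \<inter> F = {}" using p(1,2) q(1,2) r(1,2) by auto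
    show "T3 \<subseteq> T" using T1(1) T2(1) T3(1) by blast
    show "card T \<le> 64 * card T3" using T1(2) T2(2) T3(2) by linarith
    fix x y z assume i: "(x, y, z) \<in> T3"
    then have "(x, y, z) \<in> T2" "(x, y, z) \<in> T1" using T2(1) T3(1) by blast+
    then show "{x, p, p'} \<in> E \<and> {y, q, q'} \<in> E \<and> {z, r, r'} \<in> E"
      using T1(3) T2(3) T3(3)[OF i] by fastforce
  qed
qed

lemma gadget_for_many_triples:
  assumes T: "T \<subseteq> V \<times> V \<times> V" and F: "F \<subseteq> V" "100 * (card F + 7) \<le> card V"
  obtains N where "matching E N" "card N = 3" "\<Union>N \<inter> F = {}"
    "card T \<le> 64 * card {(x, y, z) \<in> T. absorbs E N {x, y, z}}"
proof -
  obtain a b c where abc: "{a, b, c} \<in> E" "{a, b, c} \<inter> F = {}"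
    by (rule edge_outside[OF F(1)]) (use F(2) in simp)
  obtain p p' q q' r r' J where dist: "distinct [a, b, c, p, p', q, q', r, r']"
    and out: "{p, p', q, q', r, r'} \<inter> F = {}" and E: "{a, p, p'} \<in> E" "{b, q, q'} \<in> E" "{c, r, r'} \<in> E"
    and J: "J \<subseteq> T" "card T \<le> 64 * card J"
      "\<And>x y z. (x, y, z) \<in> J \<Longrightarrow> {x, p, p'} \<in> E \<and> {y, q, q'} \<in> E \<and> {z, r, r'} \<in> E"
    by (rule pick_three_pairs[OF T F abc(1)]) blast
  define N where "N = {{a, p, p'}, {b, q, q'}, {c, r, r'}}"
  have "matching E N" "card N = 3"
    unfolding N_def by (rule matching_three_edges[OF tg E]; use dist in auto)+
  moreover have "\<Union>N \<inter> F = {}" unfolding N_def using abc(2) out by auto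
  moreover have "J \<subseteq> {(x, y, z) \<in> T. absorbs E N {x, y, z}}"
    using J(1,3) absorbs_gadget[OF tg dist abc(1)] unfolding N_def by blast
  then have "card J \<le> card {(x, y, z) \<in> T. absorbs E N {x, y, z}}"
    using finite_subset[OF T] finite_V by (intro card_mono) (auto intro: rev_finite_subset)
  then have "card T \<le> 64 * card {(x, y, z) \<in> T. absorbs E N {x, y, z}}" using J(2) by linarith
  ultimately show ?thesis by (rule that)
qed

lemma extend_absorbing_family:
  assumes R: "matching E R" and room: "100 * (card (\<Union>R) + 7) \<le> card V"
  obtains N where "matching E (R \<union> N)" "card (R \<union> N) = card R + 3"
    "64 * card (unabsorbed V E (R \<union> N)) \<le> 63 * card (unabsorbed V E R)"
proof -
  let ?T = "unabsorbed V E R"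
  have T: "?T \<subseteq> V \<times> V \<times> V" by (auto simp: unabsorbed_def)
  have finT: "finite ?T" using finite_subset[OF T] finite_V by simp
  obtain N where N: "matching E N" "card N = 3" "\<Union>N \<inter> \<Union>R = {}"
    "card ?T \<le> 64 * card {(x, y, z) \<in> ?T. absorbs E N {x, y, z}}"
    by (rule gadget_for_many_triples[OF T matching_card_Union(2)[OF tg R] room])
  let ?A = "{(x, y, z) \<in> ?T. absorbs E N {x, y, z}}"
  have "unabsorbed V E (R \<union> N) \<subseteq> ?T - ?A" by (auto simp: unabsorbed_def)
  then have "card (unabsorbed V E (R \<union> N)) \<le> card (?T - ?A)" using finT by (intro card_mono) auto
  also have "\<dots> = card ?T - card ?A"
    using finT by (intro card_Diff_subset) (auto intro: rev_finite_subset)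
  finally have "64 * card (unabsorbed V E (R \<union> N)) \<le> 63 * card ?T" using N(4) by linarith
  moreover have "\<Union>R \<inter> \<Union>N = {}" using N(3) by blast
  note matching_Un[OF tg R N(1) this]
  ultimately show ?thesis using that N(2) by simp
qed

lemma absorbing_family:
  assumes "100 * (9 * t + 7) \<le> card V"
  shows "\<exists>R. matching E R \<and> card R = 3 * t \<and>
    real (card (unabsorbed V E R)) \<le> (63/64) ^ t * (real (card V)) ^ 3"
  using assms
proof (induction t)
  case 0
  have "card (unabsorbed V E {}) \<le> card (V \<times> V \<times> V)"
    using finite_V by (intro card_mono) (auto simp: unabsorbed_def)
  then have "real (card (unabsorbed V E {})) \<le> real ((card V) ^ 3)"
    by (intro of_nat_mono) (simp add: card_cartesian_product power3_eq_cube)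
  then show ?case by (intro exI[of _ "{}"]) (simp add: matching_empty)
next
  case (Suc t)
  then obtain R where R: "matching E R" "card R = 3 * t"
    "real (card (unabsorbed V E R)) \<le> (63/64) ^ t * (real (card V)) ^ 3"
    by auto
  have "100 * (card (\<Union>R) + 7) \<le> card V" using Suc.prems matching_card_Union(1)[OF tg R(1)] R(2) by simp
  then obtain N where N: "matching E (R \<union> N)" "card (R \<union> N) = card R + 3"
    "64 * card (unabsorbed V E (R \<union> N)) \<le> 63 * card (unabsorbed V E R)"
    by (rule extend_absorbing_family[OF R(1)])
  have "real (card (unabsorbed V E (R \<union> N))) \<le> 63/64 * real (card (unabsorbed V E R))"
    using of_nat_mono[OF N(3), where 'a = real] by simp
  also have "\<dots> \<le> 63/64 * ((63/64) ^ t * (real (card V)) ^ 3)" using R(3) by (intro mult_left_mono) auto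
  finally have "real (card (unabsorbed V E (R \<union> N))) \<le> (63/64) ^ Suc t * (real (card V)) ^ 3" by simp
  moreover have "card (R \<union> N) = 3 * Suc t" using N(2) R(2) by simp
  ultimately show ?case using N(1) by blast
qed

end

lemma geometric_decay_beats_cube:
  assumes "10 ^ 8 \<le> t"
  shows "(63/64) ^ t * (10 ^ 6 * (real t + 1)) ^ 3 < (1 :: real)"
proof -
  define s where "s = t div 10"
  define u where "u = real t + 1"
  have u: "10 ^ 8 \<le> u" using assms by (simp add: u_def)
  have "t + 1 \<le> 10 * (s + 1)" unfolding s_def by presburger
  then have "u / 630 \<le> 1 + real s * (1/63)" by (simp add: u_def field_simps flip: of_nat_Suc)
  also have "\<dots> \<le> (1 + 1/63) ^ s" by (rule Bernoulli_inequality) simp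
  finally have "(u / 630) ^ 10 \<le> ((64/63) ^ s) ^ 10" using u by (intro power_mono) auto
  also have "\<dots> = (64/63) ^ (s * 10)" by (simp add: power_mult)
  also have "\<dots> \<le> (64/63) ^ t" by (intro power_increasing) (auto simp: s_def)
  finally have growth: "(u / 630) ^ 10 \<le> (64/63) ^ t" .
  have "(10 ^ 6) ^ 3 * 630 ^ 10 * u ^ 3 < (10 ^ 8) ^ 7 * u ^ 3"
    using u by (intro mult_strict_right_mono) auto
  also have "\<dots> \<le> u ^ 7 * u ^ 3" using u by (intro mult_right_mono power_mono) auto
  finally have "(10 ^ 6 * u) ^ 3 < (u / 630) ^ 10"
    by (simp add: power_mult_distrib power_divide field_simps flip: power_add)
  then have "(63/64) ^ t * (10 ^ 6 * u) ^ 3 < (63/64) ^ t * (64/63) ^ t"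
    using growth by (intro mult_strict_left_mono) auto
  also have "\<dots> = 1" by (simp flip: power_mult_distrib)
  finally show ?thesis by (simp add: u_def)
qed

lemma (in dense_graph) absorbing_matching:
  assumes large: "10 ^ 14 \<le> card V"
  obtains R where "matching E R" "10 ^ 6 * card R \<le> 3 * card V" "unabsorbed V E R = {}"
proof -
  define t where "t = card V div 10 ^ 6"
  have t: "10 ^ 6 * t \<le> card V" "card V \<le> 10 ^ 6 * (t + 1)" "10 ^ 8 \<le> t"
    using large unfolding t_def by auto
  have "100 * (9 * t + 7) \<le> card V" using t by simp
  from absorbing_family[OF this] obtain R where R: "matching E R" "card R = 3 * t"
    "real (card (unabsorbed V E R)) \<le> (63/64) ^ t * (real (card V)) ^ 3" by blast
  have "real (card V) \<le> 10 ^ 6 * (real t + 1)" using of_nat_mono[OF t(2), where 'a = real] by simp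
  then have "(63/64) ^ t * (real (card V)) ^ 3 \<le> (63/64) ^ t * (10 ^ 6 * (real t + 1)) ^ 3"
    by (intro mult_left_mono power_mono) auto
  then have "real (card (unabsorbed V E R)) < 1"
    using R(3) geometric_decay_beats_cube[OF t(3)] by linarith
  moreover have "finite (unabsorbed V E R)"
    by (rule finite_subset[of _ "V \<times> V \<times> V"]) (auto simp: unabsorbed_def finite_V)
  ultimately have "unabsorbed V E R = {}" by simp
  then show ?thesis using that[OF R(1)] R(2) t(1) by simp
qed

theorem dense_perfect_matching:
  assumes tg: "three_graph V E" and large: "10 ^ 14 \<le> card V" and dv: "3 dvd card V"
    and dense: "link_dense (2/3 - 1/20000) V E"
  shows "\<exists>M. perfect_matching V E M"
proof -
  interpret dense_graph V E by unfold_locales (use tg large dense in auto)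
  obtain R where R: "matching E R" "10 ^ 6 * card R \<le> 3 * card V" "unabsorbed V E R = {}"
    by (rule absorbing_matching[OF large])
  let ?U = "V - \<Union>R"
  note UR = matching_card_Union[OF tg R(1)]
  have cU: "card ?U = card V - 3 * card R" by (rule card_uncovered[OF tg R(1)])
  have "link_dense (2/3 - 1/10000) ?U (induced E ?U)"
  proof (rule link_dense_induced[OF tg])
    have "V - ?U = \<Union>R" using UR(2) by blast
    then show "2 * real (card (V - ?U)) \<le> 1/20000 * real (card V)" using UR(1) R(2) by simp
    show "(2/3 - 1/10000 + 1/20000) * (real (card V))\<^sup>2 \<le> real (card (link E v))" if "v \<in> ?U" for v
      using dense that by (simp add: link_dense_def)
  qed auto
  moreover have "90006 \<le> card ?U" "3 dvd card ?U" using cU R(2) large dv by (auto intro: dvd_diff_nat)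
  ultimately obtain M where M: "matching (induced E ?U) M" "3 * card M + 3 = card ?U"
    using near_perfect_matching[OF three_graph_induced[OF tg, of ?U]] by blast
  have ME: "matching E M" by (rule matching_mono[OF M(1)]) (auto simp: induced_def)
  have "\<Union>R \<inter> \<Union>M = {}"
    using matching_card_Union(2)[OF three_graph_induced[OF tg] M(1)] by blast
  note RM = matching_Un[OF tg R(1) ME this]
  have three: "card (V - \<Union>(R \<union> M)) = 3" using card_uncovered[OF tg RM(1)] RM(2) M(2) cU by simp
  then obtain x y z where xyz: "V - \<Union>(R \<union> M) = {x, y, z}" by (auto simp: card_3_iff)
  then have "x \<in> V" "y \<in> V" "z \<in> V" by blast+
  moreover have "(x, y, z) \<notin> unabsorbed V E R" using R(3) by simp
  ultimately obtain N where "N \<subseteq> R" "absorbs E N {x, y, z}" by (auto simp: unabsorbed_def)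
  then show ?thesis
    using perfect_matching_if_absorbs[OF tg RM(1), of N] three unfolding xyz by blast
qed

section \<open>Covering the vertices of low degree\<close>

lemma card_edges_meeting_le:
  assumes "disjoint M" "finite Z"
  shows "card {e \<in> M. e \<inter> Z \<noteq> {}} \<le> card Z"
proof -
  have "\<forall>e\<in>{e \<in> M. e \<inter> Z \<noteq> {}}. \<exists>x. x \<in> e \<inter> Z" by blast
  then obtain f where f: "\<And>e. e \<in> {e \<in> M. e \<inter> Z \<noteq> {}} \<Longrightarrow> f e \<in> e \<inter> Z" by metis
  have "inj_on f {e \<in> M. e \<inter> Z \<noteq> {}}"
  proof (rule inj_onI, rule ccontr)
    fix a b assume ab: "a \<in> {e \<in> M. e \<inter> Z \<noteq> {}}" "b \<in> {e \<in> M. e \<inter> Z \<noteq> {}}" "f a = f b" "a \<noteq> b"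
    then have "a \<inter> b = {}" using disjointD[OF assms(1)] by simp
    then show False using f[OF ab(1)] f[OF ab(2)] ab(3) by auto
  qed
  then show ?thesis using f assms(2) by (intro card_inj_on_le) auto
qed

lemma edge_avoiding:
  assumes tg: "three_graph V E" and D: "finite D" "2 * card D * card V < card (link E w)"
  obtains p q where "{w, p, q} \<in> E" "p \<notin> D" "q \<notin> D"
proof -
  have "\<not> link E w \<subseteq> {} \<union> (D \<times> V \<union> V \<times> D)"
    using card_le_add_cross[of "link E w" "{}" D V] D three_graph_finite_vertices[OF tg] by auto
  then obtain x where x: "x \<in> link E w" "x \<notin> D \<times> V \<union> V \<times> D" by blast
  obtain p q where "x = (p, q)" by (cases x)
  then have pq: "(p, q) \<in> link E w" "(p, q) \<notin> D \<times> V \<union> V \<times> D" using x by simp_all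
  moreover have "(p, q) \<in> V \<times> V" using link_subset[OF tg] pq(1) by blast
  ultimately show ?thesis using that by simp
qed

lemma greedy_cover:
  assumes tg: "three_graph V E" and W: "W \<subseteq> V" and indep: "strongly_independent E W"
    and deg: "\<And>w. w \<in> W \<Longrightarrow> 6 * card W * card V < card (link E w)"
  shows "\<exists>M. matching E M \<and> card M = card W \<and> W \<subseteq> \<Union>M"
proof -
  have finW: "finite W" using W three_graph_finite_vertices[OF tg] by (rule finite_subset)
  have "\<exists>M. matching E M \<and> card M = card X \<and> \<Union>M \<inter> W = X" if "X \<subseteq> W" for X
    using finite_subset[OF that finW] that
  proof (induction X rule: finite_induct)
    case empty
    then show ?case by (intro exI[of _ "{}"]) (simp add: matching_empty)
  next
    case (insert w X)
    then obtain M where M: "matching E M" "card M = card X" "\<Union>M \<inter> W = X" by auto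
    note U = matching_card_Union[OF tg M(1)]
    have w: "w \<in> W" "w \<notin> \<Union>M" using insert.prems insert.hyps(2) M(3) by auto
    have "card X \<le> card W" using insert.prems finW by (intro card_mono) auto
    then have "2 * card (\<Union>M) * card V \<le> 6 * card W * card V" using U(1) M(2) by simp
    then obtain p q where e: "{w, p, q} \<in> E" and pq: "p \<notin> \<Union>M" "q \<notin> \<Union>M"
      using edge_avoiding[OF tg U(3)] deg[OF w(1)] order.strict_trans1 by blast
    have "{w, p, q} \<inter> W = {w}"
      using strongly_independentD[OF indep e _ _ _ w(1)] w(1) by auto
    moreover have "\<Union>M \<inter> \<Union>{{w, p, q}} = {}" using w(2) pq by auto
    note un = matching_Un[OF tg M(1) matching_singleton[OF e] this]
    ultimately have "\<Union>(M \<union> {{w, p, q}}) \<inter> W = insert w X" using M(3) by auto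
    then show ?case
      using un M(2) insert.hyps by (intro exI[of _ "M \<union> {{w, p, q}}"]) simp
  qed
  from this[of W] show ?thesis by auto
qed

lemma perfect_matching_trim:
  assumes tg: "three_graph V F" and Z: "Z \<subseteq> V" "3 * card Z \<le> card V"
    and star: "\<And>z u u'. z \<in> Z \<Longrightarrow> u \<in> V - Z \<Longrightarrow> u' \<in> V - Z \<Longrightarrow> u \<noteq> u' \<Longrightarrow> {z, u, u'} \<in> F"
    and M: "perfect_matching V (F \<union> {e \<in> triples V. e \<inter> Z \<noteq> {}}) M"
  shows "\<exists>M'. perfect_matching V F M'"
proof -
  have finV: "finite V" by (rule three_graph_finite_vertices[OF tg])
  have finZ: "finite Z" using Z(1) finV by (rule finite_subset)
  let ?F' = "F \<union> {e \<in> triples V. e \<inter> Z \<noteq> {}}" and ?M0 = "{e \<in> M. e \<inter> Z = {}}"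
  have tg': "three_graph V ?F'" using tg by (auto simp: three_graph_iff)
  have M': "matching ?F' M" "3 * card M = card V" using M by (simp_all add: perfect_matching_iff[OF tg'])
  have "M = ?M0 \<union> {e \<in> M. e \<inter> Z \<noteq> {}}" by auto
  then have "card M \<le> card ?M0 + card {e \<in> M. e \<inter> Z \<noteq> {}}"
    using card_Un_le[of ?M0 "{e \<in> M. e \<inter> Z \<noteq> {}}"] by simp
  moreover have "card {e \<in> M. e \<inter> Z \<noteq> {}} \<le> card Z"
    using card_edges_meeting_le[OF _ finZ] M'(1) by (simp add: matching_def)
  ultimately have "card M - card Z \<le> card ?M0" by linarith
  then obtain M1 where M1: "M1 \<subseteq> ?M0" "card M1 = card M - card Z" by (rule obtain_subset_with_card_n)
  then have M1F: "matching F M1"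
    using matching_subset[OF M'(1), of M1] by (auto simp: matching_def)
  note U1 = matching_card_Union[OF tg M1F]
  have ZM1: "Z \<inter> \<Union>M1 = {}" using M1(1) by auto
  define Y where "Y = V - (Z \<union> \<Union>M1)"
  have "card (Z \<union> \<Union>M1) = card Z + 3 * (card M - card Z)"
    using ZM1 finZ U1(1,3) M1(2) by (simp add: card_Un_disjoint)
  then have cY: "card Y = 2 * card Z"
    unfolding Y_def using M'(2) Z U1(2,3) finZ by (simp add: card_Diff_subset)
  have "finite Y" "Z \<inter> Y = {}" using finV by (auto simp: Y_def)
  moreover have "{z, y, y'} \<in> F" if "z \<in> Z" "y \<in> Y" "y' \<in> Y" "y \<noteq> y'" for z y y'
    using that by (intro star) (auto simp: Y_def)
  ultimately obtain M2 where M2: "matching F M2" "\<Union>M2 = Z \<union> Y"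
    using complete_star_matching[OF finZ _ _ cY] by metis
  have "\<Union>M1 \<inter> \<Union>M2 = {}" using M2(2) ZM1 by (auto simp: Y_def)
  then have "matching F (M1 \<union> M2)" by (rule matching_Un(1)[OF tg M1F M2(1)])
  moreover have "\<Union>(M1 \<union> M2) = V" using M2(2) U1(2) Z(1) by (auto simp: Y_def)
  ultimately have "perfect_matching V F (M1 \<union> M2)" by (simp add: perfect_matching_def matching_def)
  then show ?thesis by (rule exI)
qed

lemma sub_HstarI:
  assumes tg: "three_graph V E" and dv: "3 dvd card V" and nonempty: "V \<noteq> {}"
    and W: "W \<subseteq> V" "card V < 3 * card W" and indep: "strongly_independent E W"
  shows "sub_Hstar V E"
proof -
  obtain k where k: "card V = 3 * k" using dv by blast
  have "finite V" by (rule three_graph_finite_vertices[OF tg])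
  then have "k \<ge> 1" using nonempty k by (cases k) auto
  have "k + 1 \<le> card W" using W(2) k by linarith
  then obtain S where S: "S \<subseteq> W" "card S = k + 1" "finite S" by (rule obtain_subset_with_card_n)
  have SV: "S \<subseteq> V" using S(1) W(1) by auto
  then have "card (V - S) = 3 * k - (k + 1)" using S(2,3) k by (simp add: card_Diff_subset)
  then have "real (card (V - S)) = 2 * real (card V) / 3 - 1" using k \<open>k \<ge> 1\<close> by (simp add: of_nat_diff)
  moreover have "real (card S) = real (card V) / 3 + 1" using S(2) k by simp
  moreover have "E \<subseteq> Hstar_edges S (V - S)"
  proof
    fix e assume e: "e \<in> E"
    have eV: "e \<subseteq> V" "card e = 3" "finite e"
      using tg e three_graph_finite_edge[OF tg] by (auto simp: three_graph_def)
    have "card (e \<inter> S) \<le> card (e \<inter> W)" using eV(3) S(1) by (intro card_mono) auto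
    also have "\<dots> \<le> 1" using indep e by (simp add: strongly_independent_iff_card[OF tg])
    finally have "card (e \<inter> S) \<le> 1" .
    moreover have "e \<inter> (V - S) = e - e \<inter> S" using eV(1) by auto
    then have "card (e \<inter> (V - S)) = 3 - card (e \<inter> S)" using eV by (simp add: card_Diff_subset)
    ultimately show "e \<in> Hstar_edges S (V - S)" using eV by (auto simp: Hstar_edges_def)
  qed
  ultimately show ?thesis
    unfolding sub_Hstar_def using SV by (intro exI[of _ S] exI[of _ "V - S"]) auto
qed

lemma sigma2'_le:
  assumes tg: "three_graph V E" and "hadjacent E u v"
  shows "sigma2' E \<le> hdegree E u + hdegree E v"
proof -
  have "{hdegree E u + hdegree E v | u v. hadjacent E u v} \<subseteq> (\<lambda>(u, v). hdegree E u + hdegree E v) ` (V \<times> V)"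
    using tg by (fastforce simp: hadjacent_def three_graph_def)
  moreover have "finite ((\<lambda>(u, v). hdegree E u + hdegree E v) ` (V \<times> V))"
    using tg by (simp add: three_graph_def)
  ultimately have "finite {hdegree E u + hdegree E v | u v. hadjacent E u v}" by (rule finite_subset)
  then show ?thesis unfolding sigma2'_def using assms(2) by (intro Min_le) auto
qed

section \<open>The degree-sum condition\<close>

definition eps :: real where
  "eps = 1 / 10 ^ 12"

locale ore_graph = three_uniform +
  assumes dv: "3 dvd card V" and large: "2 * 10 ^ 14 \<le> card V"
    and no_isolated: "\<And>v. v \<in> V \<Longrightarrow> link E v \<noteq> {}"
    and ore: "\<And>u v. hadjacent E u v \<Longrightarrow>
      (4/3 - 2 * eps) * (real (card V))\<^sup>2 < real (card (link E u)) + real (card (link E v))"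
begin

definition n :: real where
  "n = real (card V)"

definition low :: "'a set" where
  "low = {v \<in> V. real (card (link E v)) < (2/3 - eps) * n\<^sup>2}"

lemma n_ge: "10 ^ 14 \<le> n"
  using large by (simp add: n_def)

lemma n_le_square: "10 ^ 14 * n \<le> n\<^sup>2"
  using mult_right_mono[OF n_ge, of n] n_ge by (simp add: power2_eq_square)

lemma eps_square_pos: "0 < eps * n\<^sup>2"
  using n_ge by (simp add: eps_def)

lemma low_subset: "low \<subseteq> V"
  by (auto simp: low_def)

lemma finite_low: "finite low"
  using low_subset finite_V by (rule finite_subset)

lemma card_link_high: "u \<in> V - low \<Longrightarrow> (2/3 - eps) * n\<^sup>2 \<le> real (card (link E u))"
  by (auto simp: low_def)

lemma low_strongly_independent: "strongly_independent E low"
  unfolding strongly_independent_def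
proof (intro ballI notI)
  fix u v assume "u \<in> low" "v \<in> low" "hadjacent E u v"
  then show False using ore[of u v] by (simp add: low_def n_def algebra_simps)
qed

lemma card_link_ge_quarter:
  assumes v: "v \<in> V"
  shows "n\<^sup>2 / 4 \<le> real (card (link E v))"
proof -
  obtain p q where e: "{v, p, q} \<in> E" using no_isolated[OF v] by (auto simp: link_def)
  then have "hadjacent E v p" using three_graph_edge(1)[OF tg e] by (auto simp: hadjacent_def)
  then have "(4/3 - 2 * eps) * n\<^sup>2 < real (card (link E v)) + real (card (link E p))"
    using ore by (simp add: n_def)
  moreover have "real (card (link E p)) \<le> n\<^sup>2"
    using of_nat_mono[OF card_link_le[OF tg, of p], where 'a = real] by (simp add: n_def)
  ultimately show ?thesis using zero_le_power2[of n] by (simp add: eps_def field_simps)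
qed

theorem sub_Hstar_if_many_low: "card V < 3 * card low \<Longrightarrow> sub_Hstar V E"
  by (rule sub_HstarI[OF tg dv _ low_subset _ low_strongly_independent]) (use large in auto)

lemma cover_few_low:
  assumes few: "200000 * card low \<le> card V"
  obtains R where "matching E R" "card R = card low" "low \<subseteq> \<Union>R"
proof -
  have "6 * card low * card V < card (link E w)" if "w \<in> low" for w
  proof -
    have "200000 * real (card low) * n \<le> n * n"
      using few by (intro mult_right_mono) (simp_all add: n_def)
    then have "6 * real (card low) * n < n\<^sup>2 / 4"
      using n_ge by (simp add: power2_eq_square)
    also have "\<dots> \<le> real (card (link E w))" using card_link_ge_quarter that low_subset by blast
    finally have "real (6 * card low * card V) < real (card (link E w))" by (simp add: n_def)
    then show ?thesis by (rule of_nat_less_iff[THEN iffD1])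
  qed
  then show ?thesis
    using that greedy_cover[OF tg low_subset low_strongly_independent] by blast
qed

theorem perfect_matching_if_few_low:
  assumes few: "200000 * card low \<le> card V"
  shows "\<exists>M. perfect_matching V E M"
proof -
  obtain R where R: "matching E R" "card R = card low" "low \<subseteq> \<Union>R"
    by (rule cover_few_low[OF few])
  let ?U = "V - \<Union>R"
  note UR = matching_card_Union[OF tg R(1)]
  have cU: "card ?U = card V - 3 * card low" using card_uncovered[OF tg R(1)] R(2) by simp
  have "link_dense (2/3 - 1/20000) ?U (induced E ?U)"
  proof (rule link_dense_induced[OF tg])
    have "V - ?U = \<Union>R" using UR(2) by blast
    then show "2 * real (card (V - ?U)) \<le> (1/20000 - eps) * real (card V)"
      using UR(1) R(2) few by (simp add: eps_def)
    fix v assume "v \<in> ?U"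
    then have "v \<in> V - low" using R(3) by blast
    from card_link_high[OF this]
    show "(2/3 - 1/20000 + (1/20000 - eps)) * (real (card V))\<^sup>2 \<le> real (card (link E v))"
      by (simp add: n_def)
  qed auto
  moreover have "10 ^ 14 \<le> card ?U" "3 dvd card ?U"
    using cU few large dv by (auto intro: dvd_diff_nat)
  ultimately obtain M where "perfect_matching ?U (induced E ?U) M"
    using dense_perfect_matching[OF three_graph_induced[OF tg, of ?U]] by blast
  then show ?thesis using perfect_matching_remove[OF tg R(1)] by blast
qed

end

section \<open>An edge-maximal counterexample\<close>

lemma (in stuck_matching) link_sum_three_uncovered:
  assumes xyz: "distinct [x, y, z]" and unc: "V - \<Union>M = {x, y, z}"
    and P: "P \<subseteq> M \<times> M" "\<And>a. (a, a) \<notin> P"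
    and P17: "\<And>a b. (a, b) \<in> P \<Longrightarrow> block E x a b + block E y a b + block E z a b \<le> 17"
  shows "card (link E x) + card (link E y) + card (link E z) + card P \<le> 2 * (card V)\<^sup>2 + 27 * card V"
proof -
  have out: "{x, y, z} \<inter> \<Union>M = {}" using unc by blast
  have sum: "(\<Sum>v\<in>{x, y, z}. f v) = f x + f y + f z" for f :: "'a \<Rightarrow> nat" using xyz by simp
  have "(\<Sum>v\<in>{x, y, z}. card (link E v)) + card P
      \<le> 18 * (card M)\<^sup>2 + 9 * card {x, y, z} * card M + 2 * card {x, y, z} * card (V - \<Union>M) * card V"
  proof (rule link_sum_le[OF P])
    fix a b assume "a \<in> M" "b \<in> M" "a \<noteq> b"
    then show "(\<Sum>v\<in>{x, y, z}. block E v a b) + of_bool ((a, b) \<in> P) \<le> 18"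
      using three_blocks_le[OF _ _ _ xyz out] P17[of a b] unfolding sum by (cases "(a, b) \<in> P") auto
  qed
  moreover have "card {x, y, z} = 3" using xyz by simp
  moreover have "3 * card M \<le> card V"
    using card_mono[OF finite_V matching_card_Union(2)[OF tg M]] matching_card_Union(1)[OF tg M] by simp
  moreover from this have "(3 * card M)\<^sup>2 \<le> (card V)\<^sup>2" by (rule power_mono) simp
  ultimately show ?thesis unfolding unc sum by (simp add: power_mult_distrib)
qed

lemma (in stuck_matching) card_pairs_meeting_ge:
  assumes W: "strongly_independent E W" "finite W" "card W \<le> Suc (card (W \<inter> \<Union>M))"
  shows "(card W - 1) * (card W - 2)
    \<le> card {(a, b). a \<in> M \<and> b \<in> M \<and> a \<noteq> b \<and> a \<inter> W \<noteq> {} \<and> b \<inter> W \<noteq> {}}"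
proof -
  let ?A = "{e \<in> M. e \<inter> W \<noteq> {}}"
  have finA: "finite ?A" using finite_M by simp
  have "W \<inter> \<Union>M = (\<Union>e\<in>?A. e \<inter> W)" by auto
  then have "card (W \<inter> \<Union>M) \<le> (\<Sum>e\<in>?A. card (e \<inter> W))" using finA by (simp only:) (rule card_UN_le)
  also have "\<dots> \<le> (\<Sum>e\<in>?A. 1)"
    using W(1) M by (intro sum_mono) (auto simp: strongly_independent_iff_card[OF tg] matching_def)
  finally have "card W - 1 \<le> card ?A" using W(3) by simp
  then have "(card W - 1) * (card W - 2) \<le> card ?A * (card ?A - 1)" by (intro mult_mono) auto
  also have "\<dots> = (\<Sum>a\<in>?A. card (?A - {a}))" by (simp add: card_Diff_singleton)
  also have "\<dots> = card (SIGMA a:?A. ?A - {a})" using finA by (simp add: card_SigmaI)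
  also have "(SIGMA a:?A. ?A - {a}) = {(a, b). a \<in> M \<and> b \<in> M \<and> a \<noteq> b \<and> a \<inter> W \<noteq> {} \<and> b \<inter> W \<noteq> {}}"
    by auto
  finally show ?thesis .
qed

locale maximal_counterexample = ore_graph +
  fixes F
  assumes many: "card V \<le> 200000 * card low" and few: "3 * card low \<le> card V"
    and E_subset: "E \<subseteq> F" and tgF: "three_graph V F" and indepF: "strongly_independent F low"
    and no_matching: "\<nexists>M. perfect_matching V F M"
    and maximal: "\<And>e. e \<in> triples V - F \<Longrightarrow> card (e \<inter> low) \<le> 1 \<Longrightarrow>
      \<exists>M. matching F M \<and> 3 * Suc (card M) = card V \<and> e \<inter> \<Union>M = {}"
begin

definition d :: "'a \<Rightarrow> real" where
  "d v = real (card (link F v))"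

definition nbrs :: "'a \<Rightarrow> 'a set" where
  "nbrs w = {u. hadjacent E w u}"

definition heavy :: "'a set" where
  "heavy = {u \<in> V - low. (2/3 + 3 * eps) * n\<^sup>2 \<le> d u}"

lemma card_link_le_d: "real (card (link E v)) \<le> d v"
  unfolding d_def using card_link_mono[OF tgF E_subset] by simp

lemma d_ge_high: "u \<in> V - low \<Longrightarrow> (2/3 - eps) * n\<^sup>2 \<le> d u"
  using card_link_high card_link_le_d order_trans by blast

lemma missing_triple_matching:
  assumes "{x, y, z} \<in> triples V - F" "card ({x, y, z} \<inter> low) \<le> 1"
  obtains M where "stuck_matching V F M" "V - \<Union>M = {x, y, z}" "distinct [x, y, z]"
proof -
  obtain M where M: "matching F M" "3 * Suc (card M) = card V" "{x, y, z} \<inter> \<Union>M = {}"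
    using maximal[OF assms] by blast
  have "stuck_matching V F M"
    using tgF M(1,2) no_matching unfolding perfect_matching_iff[OF tgF]
    by unfold_locales auto
  moreover have xyz: "{x, y, z} \<subseteq> V - \<Union>M" "card {x, y, z} = 3"
    using assms(1) M(3) by (auto simp: triples_def)
  moreover have "card (V - \<Union>M) = 3" using card_uncovered[OF tgF M(1)] M(2) by simp
  then have "{x, y, z} = V - \<Union>M" using xyz finite_V by (intro card_subset_eq) auto
  ultimately show ?thesis using that card_triple_iff[of x y z] by metis
qed

lemma missing_triple_sum_le:
  assumes "{x, y, z} \<in> triples V - F" "card ({x, y, z} \<inter> low) \<le> 1"
  shows "d x + d y + d z \<le> (2 + eps / 2) * n\<^sup>2"
proof -
  obtain M where "stuck_matching V F M" and xyz: "distinct [x, y, z]" "V - \<Union>M = {x, y, z}"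
    by (rule missing_triple_matching[OF assms])
  then interpret stuck_matching V F M by blast
  have "card (link F x) + card (link F y) + card (link F z) \<le> 2 * (card V)\<^sup>2 + 27 * card V"
    using link_sum_three_uncovered[OF xyz, of "{}"] by simp
  from of_nat_mono[OF this, where 'a = real] have "d x + d y + d z \<le> 2 * n\<^sup>2 + 27 * n"
    by (simp add: d_def n_def)
  then show ?thesis using n_le_square n_ge by (simp add: eps_def algebra_simps)
qed

text \<open>Blocks between two edges that meet \<^term>\<open>low\<close> lose a pair, as \<^term>\<open>low\<close> is strongly independent.\<close>

lemma missing_triple_sum_le_low:
  assumes "{x, y, z} \<in> triples V - F" "card ({x, y, z} \<inter> low) \<le> 1" "x \<in> low"
  shows "d x + d y + d z \<le> (2 - 10 * eps) * n\<^sup>2"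
proof -
  obtain M where "stuck_matching V F M" and xyz: "distinct [x, y, z]" "V - \<Union>M = {x, y, z}"
    by (rule missing_triple_matching[OF assms(1,2)])
  then interpret stuck_matching V F M by blast
  let ?P = "{(a, b). a \<in> M \<and> b \<in> M \<and> a \<noteq> b \<and> a \<inter> low \<noteq> {} \<and> b \<inter> low \<noteq> {}}"
  have out: "{x, y, z} \<inter> \<Union>M = {}" using xyz(2) by blast
  have "card (link F x) + card (link F y) + card (link F z) + card ?P \<le> 2 * (card V)\<^sup>2 + 27 * card V"
    by (rule link_sum_three_uncovered[OF xyz])
      (use three_blocks_le_17[OF _ _ _ xyz(1) out indepF assms(3)] in auto)
  from of_nat_mono[OF this, where 'a = real]
  have sum: "d x + d y + d z + real (card ?P) \<le> 2 * n\<^sup>2 + 27 * n" by (simp add: d_def n_def)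
  have "{x, y, z} \<inter> low = {x}"
    using card_seteq[of "{x, y, z} \<inter> low" "{x}"] assms(2,3) by simp
  then have "low \<subseteq> insert x (low \<inter> \<Union>M)" using low_subset xyz(2) by blast
  then have "card low \<le> card (insert x (low \<inter> \<Union>M))" using finite_low by (intro card_mono) auto
  also have "\<dots> \<le> Suc (card (low \<inter> \<Union>M))" using finite_low by (simp add: card_insert_if)
  finally have "(card low - 1) * (card low - 2) \<le> card ?P"
    by (rule card_pairs_meeting_ge[OF indepF finite_low])
  moreover have "card low \<ge> 2" using many large by simp
  ultimately have "(real (card low) - 1) * (real (card low) - 2) \<le> real (card ?P)"
    using of_nat_mono[of "(card low - 1) * (card low - 2)" "card ?P", where 'a = real] by (simp add: of_nat_diff)
  then have "(real (card low))\<^sup>2 \<le> real (card ?P) + 3 * real (card low)"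
    by (simp add: algebra_simps power2_eq_square)
  moreover have "3 * real (card low) \<le> n" using few by (simp add: n_def)
  moreover have "n\<^sup>2 \<le> (200000 * real (card low))\<^sup>2"
    using many unfolding n_def by (intro power_mono) auto
  ultimately have "n\<^sup>2 / 40000000000 \<le> real (card ?P) + n" by (simp add: power_mult_distrib)
  then show ?thesis using sum n_le_square n_ge by (simp add: eps_def algebra_simps)
qed

lemma high_pair_triple:
  assumes "x \<in> V" "y \<in> V - low" "z \<in> V - low" "distinct [x, y, z]"
  shows "{x, y, z} \<in> triples V" "card ({x, y, z} \<inter> low) \<le> 1"
proof -
  show "{x, y, z} \<in> triples V" using assms by (auto simp: triples_def card_triple_iff)
  have "{x, y, z} \<inter> low \<subseteq> {x}" using assms by auto
  from card_mono[OF _ this] show "card ({x, y, z} \<inter> low) \<le> 1" by simp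
qed

lemma edge_if_sum_gt:
  assumes "x \<in> V" "y \<in> V - low" "z \<in> V - low" "distinct [x, y, z]" "(2 + eps / 2) * n\<^sup>2 < d x + d y + d z"
  shows "{x, y, z} \<in> F"
  using missing_triple_sum_le[of x y z] high_pair_triple[OF assms(1-4)] assms(5) by fastforce

lemma low_edge_if_sum_gt:
  assumes "w \<in> low" "y \<in> V - low" "z \<in> V - low" "y \<noteq> z" "(2 - 10 * eps) * n\<^sup>2 < d w + d y + d z"
  shows "{w, y, z} \<in> F"
proof -
  have "w \<in> V" "distinct [w, y, z]" using assms low_subset by auto
  from high_pair_triple[OF this(1) assms(2,3) this(2)] show ?thesis
    using missing_triple_sum_le_low[of w y z] assms(1,5) by fastforce
qed

lemma edge_low_neighbour:
  assumes "w \<in> low" "u \<in> nbrs w" "u \<in> V - low" "u' \<in> V - low" "u \<noteq> u'"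
  shows "{w, u, u'} \<in> F"
proof (rule low_edge_if_sum_gt[OF assms(1,3-5)])
  have "(4/3 - 2 * eps) * n\<^sup>2 < real (card (link E w)) + real (card (link E u))"
    using ore assms(2) by (simp add: nbrs_def n_def)
  then have "(4/3 - 2 * eps) * n\<^sup>2 < d w + d u"
    using card_link_le_d[of w] card_link_le_d[of u] by linarith
  then show "(2 - 10 * eps) * n\<^sup>2 < d w + d u + d u'"
    using d_ge_high[OF assms(4)] eps_square_pos by (simp add: algebra_simps)
qed

lemma edge_heavy:
  assumes "b \<in> heavy" "u \<in> V - low" "u' \<in> V - low" "distinct [b, u, u']"
  shows "{b, u, u'} \<in> F"
proof (rule edge_if_sum_gt[OF _ assms(2-4)])
  show "b \<in> V" using assms(1) by (simp add: heavy_def)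
  have "(2/3 + 3 * eps) * n\<^sup>2 \<le> d b" using assms(1) by (simp add: heavy_def)
  then show "(2 + eps / 2) * n\<^sup>2 < d b + d u + d u'"
    using d_ge_high[OF assms(2)] d_ge_high[OF assms(3)] eps_square_pos by (simp add: algebra_simps)
qed

lemma heavy_subset: "heavy \<subseteq> V - low"
  by (auto simp: heavy_def)

lemma finite_heavy: "finite heavy"
  using heavy_subset finite_V by (auto intro: finite_subset)

lemma nbrs_subset: "w \<in> low \<Longrightarrow> nbrs w \<subseteq> V - low"
  using low_strongly_independent tg
  by (auto simp: nbrs_def strongly_independent_def hadjacent_def three_graph_def)

lemma card_nbrs_ge:
  assumes w: "w \<in> low"
  shows "card V \<le> 2 * card (nbrs w)"
proof -
  have "finite (nbrs w)" using nbrs_subset[OF w] finite_V by (auto intro: finite_subset)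
  moreover have "link E w \<subseteq> nbrs w \<times> nbrs w"
  proof
    fix x assume "x \<in> link E w"
    moreover obtain p q where x: "x = (p, q)" by (cases x)
    ultimately have e: "{w, p, q} \<in> E" by simp
    then show "x \<in> nbrs w \<times> nbrs w"
      using three_graph_edge(1)[OF tg e] x by (auto simp: nbrs_def hadjacent_def)
  qed
  ultimately have "card (link E w) \<le> card (nbrs w) * card (nbrs w)"
    using card_mono[of "nbrs w \<times> nbrs w" "link E w"] by (simp add: card_cartesian_product)
  then have "real (card (link E w)) \<le> real (card (nbrs w) * card (nbrs w))" by (rule of_nat_mono)
  moreover have "n\<^sup>2 / 4 \<le> real (card (link E w))" using card_link_ge_quarter w low_subset by blast
  ultimately have "n\<^sup>2 \<le> (2 * real (card (nbrs w)))\<^sup>2" by (simp add: power2_eq_square)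
  then have "n \<le> 2 * real (card (nbrs w))" by (rule power2_le_imp_le) simp
  then show ?thesis unfolding n_def by linarith
qed

text \<open>Otherwise \<^term>\<open>low\<close> and some heavy vertices make up a third of the vertices; each of them is
  matched to two of the remaining vertices, the first of which is a neighbour for vertices in \<^term>\<open>low\<close>.\<close>

lemma few_heavy: "3 * (card low + card heavy) < card V"
proof (rule ccontr)
  assume contra: "\<not> ?thesis"
  obtain k where k: "card V = 3 * k" using dv by blast
  have "k - card low \<le> card heavy" using contra k by simp
  then obtain B where B: "B \<subseteq> heavy" "card B = k - card low" "finite B" by (rule obtain_subset_with_card_n)
  have kl: "card low \<le> k" using few k by simp
  have disj: "low \<inter> B = {}" using B(1) heavy_subset by auto
  define Y where "Y = V - (low \<union> B)"
  have cZ: "card (low \<union> B) = k" using disj finite_low B(2,3) kl by (simp add: card_Un_disjoint)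
  have ZV: "low \<union> B \<subseteq> V" using low_subset B(1) heavy_subset by auto
  have cY: "card Y = 2 * card (low \<union> B)"
    unfolding Y_def using ZV cZ k finite_low B(3) by (simp add: card_Diff_subset)
  have finY: "finite Y" and YU: "Y \<subseteq> V - low" using finite_V by (auto simp: Y_def)
  have "(low \<union> B) \<inter> Y = {}" by (auto simp: Y_def)
  moreover have "nbrs w - B \<subseteq> Y" if "w \<in> low" for w
    using nbrs_subset[OF that] by (auto simp: Y_def)
  moreover have "card low \<le> card (nbrs w - B)" if "w \<in> low" for w
    using diff_card_le_card_Diff[OF B(3), of "nbrs w"] card_nbrs_ge[OF that] k B(2) kl by linarith
  moreover have "{w, u, y} \<in> F" if "w \<in> low" "u \<in> nbrs w - B" "y \<in> Y" "u \<noteq> y" for w u y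
    using that nbrs_subset YU by (intro edge_low_neighbour) auto
  moreover have "{b, y, y'} \<in> F" if "b \<in> B" "y \<in> Y" "y' \<in> Y" "y \<noteq> y'" for b y y'
    using that B(1) YU by (intro edge_heavy) (auto simp: Y_def)
  ultimately obtain M where "matching F M" "card M = card (low \<union> B)"
    by (rule star_matching_prescribed[OF finite_low B(3) finY disj _ cY])
  then show False using no_matching cZ k by (auto simp: perfect_matching_iff[OF tgF])
qed

lemma d_ge_low:
  assumes w: "w \<in> low"
  shows "(2/3 - 5 * eps) * n\<^sup>2 \<le> d w"
proof -
  have "card heavy < card (nbrs w)" using few_heavy card_nbrs_ge[OF w] by simp
  then have "\<not> nbrs w \<subseteq> heavy" using card_mono[OF finite_heavy, of "nbrs w"] by auto
  then obtain u where u: "u \<in> nbrs w" "u \<notin> heavy" by auto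
  then have "d u < (2/3 + 3 * eps) * n\<^sup>2" using nbrs_subset[OF w] by (auto simp: heavy_def)
  moreover have "(4/3 - 2 * eps) * n\<^sup>2 < real (card (link E w)) + real (card (link E u))"
    using ore u(1) by (simp add: nbrs_def n_def)
  ultimately show ?thesis
    using card_link_le_d[of w] card_link_le_d[of u] by (simp add: algebra_simps)
qed

lemma edge_core:
  assumes z: "z \<in> low \<union> heavy" and u: "u \<in> V - low" "u' \<in> V - low" "distinct [z, u, u']"
  shows "{z, u, u'} \<in> F"
proof (cases "z \<in> heavy")
  case True
  then show ?thesis using edge_heavy u by blast
next
  case False
  then have "z \<in> low" using z by simp
  moreover from this have "(2 - 10 * eps) * n\<^sup>2 < d z + d u + d u'"
    using d_ge_low d_ge_high[OF u(1)] d_ge_high[OF u(2)] eps_square_pos by (fastforce simp: algebra_simps)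
  ultimately show ?thesis using low_edge_if_sum_gt[OF _ u(1,2)] u(3) by simp
qed

lemma link_dense_completed:
  "link_dense (2/3 - 1/20000) V (F \<union> {e \<in> triples V. e \<inter> (low \<union> heavy) \<noteq> {}})"
  (is "link_dense _ V ?F'")
  unfolding link_dense_def
proof
  have tg': "three_graph V ?F'" using tgF by (auto simp: three_graph_iff)
  fix v assume v: "v \<in> V"
  show "(2/3 - 1/20000) * (real (card V))\<^sup>2 \<le> real (card (link ?F' v))"
  proof (cases "v \<in> low \<union> heavy")
    case True
    then have "(card V - 1) * (card V - 2) \<le> card (link ?F' v)"
      by (intro card_link_complete_star[OF tg' v]) (auto simp: triples_def)
    from of_nat_mono[OF this, where 'a = real] have "(n - 1) * (n - 2) \<le> real (card (link ?F' v))"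
      using large by (simp add: n_def of_nat_diff)
    then have "n\<^sup>2 - 3 * n \<le> real (card (link ?F' v))" using n_ge by (simp add: algebra_simps power2_eq_square)
    then show ?thesis using n_le_square n_ge by (simp add: n_def[symmetric] field_simps)
  next
    case False
    then have "(2/3 - eps) * n\<^sup>2 \<le> d v" using v by (intro d_ge_high) auto
    moreover have "(2/3 - 1/20000) * n\<^sup>2 \<le> (2/3 - eps) * n\<^sup>2"
      by (intro mult_right_mono) (simp_all add: eps_def)
    moreover have "d v \<le> real (card (link ?F' v))"
      unfolding d_def using card_link_mono[OF tg', of F v] by simp
    ultimately show ?thesis by (simp add: n_def)
  qed
qed

lemma contradiction: False
proof -
  let ?Z = "low \<union> heavy"
  have tg': "three_graph V (F \<union> {e \<in> triples V. e \<inter> ?Z \<noteq> {}})" using tgF by (auto simp: three_graph_iff)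
  have "10 ^ 14 \<le> card V" using large by simp
  then obtain M where M: "perfect_matching V (F \<union> {e \<in> triples V. e \<inter> ?Z \<noteq> {}}) M"
    using dense_perfect_matching[OF tg' _ dv link_dense_completed] by blast
  have "?Z \<subseteq> V" using low_subset heavy_subset by blast
  moreover have "3 * card ?Z \<le> card V" using few_heavy card_Un_le[of low heavy] by simp
  moreover have "{z, u, u'} \<in> F" if "z \<in> ?Z" "u \<in> V - ?Z" "u' \<in> V - ?Z" "u \<noteq> u'" for z u u'
    using that by (intro edge_core) auto
  ultimately show False using perfect_matching_trim[OF tgF _ _ _ M] no_matching by blast
qed

end

theorem (in ore_graph) perfect_matching_if_medium_low:
  assumes many: "card V \<le> 200000 * card low" and few: "3 * card low \<le> card V"
  shows "\<exists>M. perfect_matching V E M"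
proof (rule ccontr)
  assume contra: "\<not> ?thesis"
  obtain k where k: "card V = 3 * k" using dv by blast
  let ?C = "{e \<in> triples V. card (e \<inter> low) \<le> 1}"
  have tgC: "three_graph V ?C" using finite_V by (auto simp: three_graph_iff)
  have "E \<subseteq> ?C"
    using tg low_strongly_independent by (auto simp: three_graph_iff strongly_independent_iff_card[OF tg])
  moreover have "\<nexists>M. matching E M \<and> card M = k" using contra k by (auto simp: perfect_matching_iff[OF tg])
  ultimately obtain F where F: "E \<subseteq> F" "F \<subseteq> ?C" "\<nexists>M. matching F M \<and> card M = k"
    and max: "\<And>e. e \<in> ?C - F \<Longrightarrow> \<exists>M. matching F M \<and> Suc (card M) = k \<and> e \<inter> \<Union>M = {}"
    by (rule edge_maximal_supergraph[OF tgC]) blast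
  have tgF: "three_graph V F" by (rule three_graph_subset[OF tgC F(2)])
  interpret maximal_counterexample V E F
  proof
    show "strongly_independent F low" using F(2) by (auto simp: strongly_independent_iff_card[OF tgF])
    show "\<nexists>M. perfect_matching V F M" using F(3) k by (auto simp: perfect_matching_iff[OF tgF])
    show "\<exists>M. matching F M \<and> 3 * Suc (card M) = card V \<and> e \<inter> \<Union>M = {}"
      if "e \<in> triples V - F" "card (e \<inter> low) \<le> 1" for e
      using max[of e] that k by auto
  qed (fact many few F(1) tgF)+
  show False by (rule contradiction)
qed

theorem theorem1p2:
  "\<exists>\<epsilon>::real. \<epsilon> > 0 \<and> (\<exists>n0::nat. \<forall>n\<ge>n0. 3 dvd n \<longrightarrow>
     (\<forall>(V :: 'a set) E. three_graph V E \<longrightarrow> card V = n \<longrightarrow>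
        (\<forall>v\<in>V. hdegree E v \<noteq> 0) \<longrightarrow>
        real (sigma2' E) > 2 / 3 * (real n)\<^sup>2 - \<epsilon> * (real n)\<^sup>2 \<longrightarrow>
        sub_Hstar V E \<or> (\<exists>M. perfect_matching V E M)))"
proof (intro exI conjI allI impI)
  show "eps > 0" by (simp add: eps_def)
  fix n :: nat and V :: "'a set" and E
  assume n: "2 * 10 ^ 14 \<le> n" "3 dvd n" and tg: "three_graph V E" and V: "card V = n"
    and no_isolated: "\<forall>v\<in>V. hdegree E v \<noteq> 0"
    and sigma: "real (sigma2' E) > 2 / 3 * (real n)\<^sup>2 - eps * (real n)\<^sup>2"
  interpret ore_graph V E
  proof
    show "link E v \<noteq> {}" if "v \<in> V" for v using no_isolated that card_link[OF tg, of v] by force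
    show "(4/3 - 2 * eps) * (real (card V))\<^sup>2 < real (card (link E u)) + real (card (link E v))"
      if "hadjacent E u v" for u v
      using sigma of_nat_mono[OF sigma2'_le[OF tg that], where 'a = real] V
      by (simp add: card_link[OF tg] algebra_simps)
  qed (use n tg V in simp_all)
  show "sub_Hstar V E \<or> (\<exists>M. perfect_matching V E M)"
    using sub_Hstar_if_many_low perfect_matching_if_few_low perfect_matching_if_medium_low
    by (meson linorder_le_cases not_le)
qed

end
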